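(* Let $J\colon\mathcal{C}\to\mathcal{D}$ be a pseudofunctor between bicategories. Suppose given the following data, referred to as $T\colon\mathcal{C}\to\mathcal{D}$: an object $TX\in\mathcal{D}$ and a morphism $i_X\colon JX\to TX$ in $\mathcal{D}$ for every $X\in\mathcal{C}$; and, for every $f\colon JX\to TY$ in $\mathcal{D}$, a morphism $f^*\colon TX\to TY$ and an invertible 2-cell $\eta_f\colon f\to f^*i_X$ exhibiting $f^*$ as the left extension of $f$ along $i_X$. Then the following conditions are equivalent: (i) $T\colon\mathcal{C}\to\mathcal{D}$ (with the given data) admits the structure of a lax idempotent relative pseudomonad over $J$. (ii) For every $f\colon JX\to TY$, the 2-cell $\varepsilon_{f^*}\colon(f^*i_X)^*\to f^*$ is invertible, and there are isomorphisms $\mu_{g,f}\colon(g^*f)^*\to g^*f^*$ (for all $f\colon JX\to TY$, $g\colon JY\to TZ$) and $\theta_X\colon(i_X)^*\to1_{TX}$ (for all $X\in\mathcal{C}$). (iii) The bicategory $\mathcal{E}$ with objects of the form $TX$, for $X\in\mathcal{C}$, and with $\mathcal{E}[TX,TY]$ defined to be the full subcategory of $\mathcal{D}[TX,TY]$ spanned by the morphisms $u\colon TX\to TY$ such that $u\cong f^*$ for some $f\colon JX\to TY$ in $\mathcal{D}$, is a sub-bicategory of $\mathcal{D}$. (iv) There exists a sub-bicategory $\mathcal{E}$ of $\mathcal{D}$ such that $f^*\colon TX\to TY$ is in $\mathcal{E}$ for all $f\colon JX\to TY$ in $\mathcal{D}$, and $\varepsilon_u\colon(u\,i_X)^*\to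 u$ is invertible for all $u\colon TX\to TY$ in $\mathcal{E}$. (v) $T\colon\mathcal{C}\to\mathcal{D}$ is a relative left Kan pseudomonad over $J$.
   Context: Associativity and unit isomorphisms of bicategories are suppressed; "$\cdot$" is vertical composition of 2-cells, juxtaposition is composition of morphisms and whiskering. Left extension. Given $i\colon X\to X'$ and $f\colon X\to Y$ in a bicategory, a morphism $f'\colon X'\to Y$ with a 2-cell $\eta\colon f\to f'i$ is a left extension of $f$ along $i$ (and $\eta$ exhibits $f'$ as such) if, for every $g\colon X'\to Y$, the map $\phi\mapsto(\phi i)\cdot\eta$ is a bijection from 2-cells $f'\to g$ to 2-cells $f\to gi$. The functors and 2-cells determined by the data. By the universal property of left extensions, for all $X,Y\in\mathcal{C}$ the assignment $f\mapsto f^*$ extends to a functor $(-)^*\colon\mathcal{D}[JX,TY]\to\mathcal{D}[TX,TY]$ left adjoint to $(-)\,i_X\colon\mathcal{D}[TX,TY]\to\mathcal{D}[JX,TY]$, with unit components $\eta_f$; the counit components are denoted $\varepsilon_u\colon(u\,i_X)^*\to u$, for $u\colon TX\to TY$. A sub-bicategory of $\mathcal{D}$ is required to contain the identity morphisms of its objects and be closed under composition. Relative pseudomonad. A relative pseudomonad $T$ over $J\colon\mathcal{C}\to\mathcal{D}$ consists of: an object $TX\in\mathcal{D}$ for each $X\in\mathcal{C}$; functors $(-)^*\colon\mathcal{D}[JX,TY]\to\mathcal{D}[TX,TY]$; morphisms $i_X\colon JX\to TX$; invertible 2-cells $\mu_{g,f}\colon(g^*f)^*\to g^*f^*$, natural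 in $f\colon JX\to TY$, $g\colon JY\to TZ$; invertible 2-cells $\eta_f\colon f\to f^*i_X$, natural in $f$; invertible 2-cells $\theta_X\colon (i_X)^*\to 1_{TX}$; such that, for $f\colon JX\to TY$, $g\colon JY\to TZ$, $h\colon JZ\to TV$, one has $(h^*\mu_{g,f})\cdot\mu_{h,g^*f}\cdot(\mu_{h,g}f)^*=(\mu_{h,g}f^* )\cdot\mu_{h^*g,f}$ and $(f^*\theta_X)\cdot\mu_{f,i_X}\cdot(\eta_f)^*=1_{f^*}$. Lax idempotent relative pseudomonad. A relative pseudomonad $T$ over $J$ is lax idempotent if: for all $f\colon JX\to TY$, $\eta_f\colon f\to f^*i_X$ exhibits $f^*$ as a left extension of $f$ along $i_X$; for all $f\colon JX\to TY$, $g\colon JY\to TZ$, $(\mu_{g,f}i_X)\cdot\eta_{g^*f}=g^*\eta_f$; for all $X\in\mathcal{C}$, $(\theta_Xi_X)\cdot\eta_{i_X}=1_{i_X}$. Relative left Kan pseudomonad. A relative left Kan pseudomonad over $J$ consists of: objects $TX\in\mathcal{D}$ and morphisms $i_X\colon JX\to TX$ for $X\in\mathcal{C}$; and, for every $f\colon JX\to TY$, a morphism $f^*\colon TX\to TY$ and an invertible 2-cell $\eta_f\colon f\to f^*i_X$ exhibiting $f^*$ as the left extension of $f$ along $i_X$; such that: for all $f\colon JX\to TY$, $g\colon JY\to TZ$, the 2-cell $g^*\eta_f\colon g^*f\to g^*f^*i_X$ exhibits $g^*f^*$ as the left extension of $g^*f$ along $i_X$; and for all $X\in\mathcal{C}$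 the identity 2-cell $i_X\to i_X$ exhibits $1_{TX}$ as a left extension of $i_X$ along $i_X$. *)

theory Defs
  imports Main
begin

section \<open>Bicategories\<close>

text \<open>Every 1-cell determines its source and target, and every 2-cell its domain and codomain, so
  the hom-categories of a bicategory are disjoint. \<open>v \<odot> u\<close> is composition of 1-cells
  (first \<open>u\<close>, then \<open>v\<close>), \<open>\<beta> \<cdot> \<alpha>\<close> is vertical and \<open>\<beta> \<star> \<alpha>\<close> horizontal composition of
  2-cells. The operations are only meaningful on composable arguments in the carrier sets.\<close>

record ('o, 'a, 'c) bicat =
  Obj :: "'o set"
  Arr :: "'a set"
  Src :: "'a \<Rightarrow> 'o"
  Trg :: "'a \<Rightarrow> 'o"
  Cell :: "'c set"
  Dom :: "'c \<Rightarrow> 'a"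
  Cod :: "'c \<Rightarrow> 'a"
  id1 :: "'o \<Rightarrow> 'a"
  comp1 :: "'a \<Rightarrow> 'a \<Rightarrow> 'a" (infixr \<open>\<odot>\<index>\<close> 75)
  id2 :: "'a \<Rightarrow> 'c"
  vcomp :: "'c \<Rightarrow> 'c \<Rightarrow> 'c" (infixr \<open>\<cdot>\<index>\<close> 60)
  hcomp :: "'c \<Rightarrow> 'c \<Rightarrow> 'c" (infixr \<open>\<star>\<index>\<close> 65)
  assoc :: "'a \<Rightarrow> 'a \<Rightarrow> 'a \<Rightarrow> 'c"
  lunit :: "'a \<Rightarrow> 'c"
  runit :: "'a \<Rightarrow> 'c"

definition hom :: "('o, 'a, 'c) bicat \<Rightarrow> 'o \<Rightarrow> 'o \<Rightarrow> 'a set"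
  where "hom B X Y = {u \<in> Arr B. Src B u = X \<and> Trg B u = Y}"

definition cells :: "('o, 'a, 'c) bicat \<Rightarrow> 'a \<Rightarrow> 'a \<Rightarrow> 'c set"
  where "cells B u v = {\<alpha> \<in> Cell B. Dom B \<alpha> = u \<and> Cod B \<alpha> = v}"

definition whisker_left :: "('o, 'a, 'c) bicat \<Rightarrow> 'a \<Rightarrow> 'c \<Rightarrow> 'c" (infixr \<open>\<lhd>\<index>\<close> 65)
  where "whisker_left B v \<alpha> = id2 B v \<star>\<^bsub>B\<^esub> \<alpha>"

definition whisker_right :: "('o, 'a, 'c) bicat \<Rightarrow> 'c \<Rightarrow> 'a \<Rightarrow> 'c" (infixl \<open>\<rhd>\<index>\<close> 65)
  where "whisker_right B \<alpha> u = \<alpha> \<star>\<^bsub>B\<^esub> id2 B u"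

definition inverse_cells :: "('o, 'a, 'c) bicat \<Rightarrow> 'c \<Rightarrow> 'c \<Rightarrow> bool"
  where "inverse_cells B \<alpha> \<beta> \<longleftrightarrow>
    \<alpha> \<in> Cell B \<and> \<beta> \<in> cells B (Cod B \<alpha>) (Dom B \<alpha>) \<and>
    \<beta> \<cdot>\<^bsub>B\<^esub> \<alpha> = id2 B (Dom B \<alpha>) \<and> \<alpha> \<cdot>\<^bsub>B\<^esub> \<beta> = id2 B (Cod B \<alpha>)"

definition invertible :: "('o, 'a, 'c) bicat \<Rightarrow> 'c \<Rightarrow> bool"
  where "invertible B \<alpha> \<longleftrightarrow> (\<exists>\<beta>. inverse_cells B \<alpha> \<beta>)"

definition inv2 :: "('o, 'a, 'c) bicat \<Rightarrow> 'c \<Rightarrow> 'c"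
  where "inv2 B \<alpha> = (THE \<beta>. inverse_cells B \<alpha> \<beta>)"

definition isos :: "('o, 'a, 'c) bicat \<Rightarrow> 'a \<Rightarrow> 'a \<Rightarrow> 'c set"
  where "isos B u v = {\<alpha> \<in> cells B u v. invertible B \<alpha>}"

definition isomorphic :: "('o, 'a, 'c) bicat \<Rightarrow> 'a \<Rightarrow> 'a \<Rightarrow> bool"
  where "isomorphic B u v \<longleftrightarrow> (\<exists>\<alpha>. \<alpha> \<in> isos B u v)"

locale bicategory =
  fixes B :: "('o, 'a, 'c) bicat" (structure)
  assumes src_trg: "u \<in> Arr B \<Longrightarrow> Src B u \<in> Obj B \<and> Trg B u \<in> Obj B"
    and dom_cod: "\<alpha> \<in> Cell B \<Longrightarrow> Dom B \<alpha> \<in> Arr B \<and> Cod B \<alpha> \<in> Arr B \<and>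
      Src B (Dom B \<alpha>) = Src B (Cod B \<alpha>) \<and> Trg B (Dom B \<alpha>) = Trg B (Cod B \<alpha>)"
    and id1_hom: "X \<in> Obj B \<Longrightarrow> id1 B X \<in> hom B X X"
    and comp1_hom: "\<lbrakk>u \<in> hom B X Y; v \<in> hom B Y Z\<rbrakk> \<Longrightarrow> v \<odot> u \<in> hom B X Z"
    and id2_cells: "u \<in> Arr B \<Longrightarrow> id2 B u \<in> cells B u u"
    and vcomp_cells: "\<lbrakk>\<alpha> \<in> cells B u v; \<beta> \<in> cells B v w\<rbrakk> \<Longrightarrow> \<beta> \<cdot> \<alpha> \<in> cells B u w"
    and vcomp_id_left: "\<alpha> \<in> cells B u v \<Longrightarrow> id2 B v \<cdot> \<alpha> = \<alpha>"
    and vcomp_id_right: "\<alpha> \<in> cells B u v \<Longrightarrow> \<alpha> \<cdot> id2 B u = \<alpha>"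
    and vcomp_assoc: "\<lbrakk>\<alpha> \<in> cells B u v; \<beta> \<in> cells B v w; \<gamma> \<in> cells B w x\<rbrakk> \<Longrightarrow>
      (\<gamma> \<cdot> \<beta>) \<cdot> \<alpha> = \<gamma> \<cdot> (\<beta> \<cdot> \<alpha>)"
    and hcomp_cells: "\<lbrakk>u \<in> hom B X Y; v \<in> hom B Y Z; \<alpha> \<in> cells B u u'; \<beta> \<in> cells B v v'\<rbrakk> \<Longrightarrow>
      \<beta> \<star> \<alpha> \<in> cells B (v \<odot> u) (v' \<odot> u')"
    and hcomp_id: "\<lbrakk>u \<in> hom B X Y; v \<in> hom B Y Z\<rbrakk> \<Longrightarrow> id2 B v \<star> id2 B u = id2 B (v \<odot> u)"
    and interchange: "\<lbrakk>u \<in> hom B X Y; v \<in> hom B Y Z;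
      \<alpha> \<in> cells B u u'; \<alpha>' \<in> cells B u' u''; \<beta> \<in> cells B v v'; \<beta>' \<in> cells B v' v''\<rbrakk> \<Longrightarrow>
      (\<beta>' \<cdot> \<beta>) \<star> (\<alpha>' \<cdot> \<alpha>) = (\<beta>' \<star> \<alpha>') \<cdot> (\<beta> \<star> \<alpha>)"
    and assoc_isos: "\<lbrakk>u \<in> hom B W X; v \<in> hom B X Y; w \<in> hom B Y Z\<rbrakk> \<Longrightarrow>
      assoc B w v u \<in> isos B ((w \<odot> v) \<odot> u) (w \<odot> (v \<odot> u))"
    and assoc_natural: "\<lbrakk>u \<in> hom B W X; v \<in> hom B X Y; w \<in> hom B Y Z;
      \<alpha> \<in> cells B u u'; \<beta> \<in> cells B v v'; \<gamma> \<in> cells B w w'\<rbrakk> \<Longrightarrow>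
      assoc B w' v' u' \<cdot> ((\<gamma> \<star> \<beta>) \<star> \<alpha>) = (\<gamma> \<star> (\<beta> \<star> \<alpha>)) \<cdot> assoc B w v u"
    and lunit_isos: "u \<in> hom B X Y \<Longrightarrow> lunit B u \<in> isos B (id1 B Y \<odot> u) u"
    and lunit_natural: "\<lbrakk>u \<in> hom B X Y; \<alpha> \<in> cells B u u'\<rbrakk> \<Longrightarrow>
      lunit B u' \<cdot> (id1 B Y \<lhd> \<alpha>) = \<alpha> \<cdot> lunit B u"
    and runit_isos: "u \<in> hom B X Y \<Longrightarrow> runit B u \<in> isos B (u \<odot> id1 B X) u"
    and runit_natural: "\<lbrakk>u \<in> hom B X Y; \<alpha> \<in> cells B u u'\<rbrakk> \<Longrightarrow>
      runit B u' \<cdot> (\<alpha> \<rhd> id1 B X) = \<alpha> \<cdot> runit B u"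
    and pentagon: "\<lbrakk>u \<in> hom B V W; v \<in> hom B W X; w \<in> hom B X Y; x \<in> hom B Y Z\<rbrakk> \<Longrightarrow>
      (x \<lhd> assoc B w v u) \<cdot> assoc B x (w \<odot> v) u \<cdot> (assoc B x w v \<rhd> u) =
      assoc B x w (v \<odot> u) \<cdot> assoc B (x \<odot> w) v u"
    and triangle: "\<lbrakk>u \<in> hom B X Y; v \<in> hom B Y Z\<rbrakk> \<Longrightarrow>
      (v \<lhd> lunit B u) \<cdot> assoc B v (id1 B Y) u = runit B v \<rhd> u"

text \<open>A sub-bicategory of \<open>D\<close> has as carriers subsets of those of \<open>D\<close> and inherits all operations
  of \<open>D\<close>. Being a bicategory forces the carriers to contain identities and to be closed under all
  compositions and under the constraint 2-cells and their inverses. It need not be locally full.\<close>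

definition sub_bicategory :: "('o, 'a, 'c) bicat \<Rightarrow> ('o, 'a, 'c) bicat \<Rightarrow> bool"
  where "sub_bicategory E D \<longleftrightarrow>
    Obj E \<subseteq> Obj D \<and> Arr E \<subseteq> Arr D \<and> Cell E \<subseteq> Cell D \<and>
    E = D\<lparr>Obj := Obj E, Arr := Arr E, Cell := Cell E\<rparr> \<and> bicategory E"


section \<open>Pseudofunctors\<close>

record ('p, 'b, 'e, 'o, 'a, 'c) psfunctor =
  F0 :: "'p \<Rightarrow> 'o"
  F1 :: "'b \<Rightarrow> 'a"
  F2 :: "'e \<Rightarrow> 'c"
  Fcomp :: "'b \<Rightarrow> 'b \<Rightarrow> 'c"
  Funit :: "'p \<Rightarrow> 'c"

locale pseudofunctor =
  C: bicategory C + D: bicategory D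
  for C :: "('p, 'b, 'e) bicat" and D :: "('o, 'a, 'c) bicat" +
  fixes F :: "('p, 'b, 'e, 'o, 'a, 'c) psfunctor"
  assumes F0_Obj: "X \<in> Obj C \<Longrightarrow> F0 F X \<in> Obj D"
    and F1_hom: "u \<in> hom C X Y \<Longrightarrow> F1 F u \<in> hom D (F0 F X) (F0 F Y)"
    and F2_cells: "\<alpha> \<in> cells C u v \<Longrightarrow> F2 F \<alpha> \<in> cells D (F1 F u) (F1 F v)"
    and F2_id: "u \<in> Arr C \<Longrightarrow> F2 F (id2 C u) = id2 D (F1 F u)"
    and F2_vcomp: "\<lbrakk>\<alpha> \<in> cells C u v; \<beta> \<in> cells C v w\<rbrakk> \<Longrightarrow>
      F2 F (\<beta> \<cdot>\<^bsub>C\<^esub> \<alpha>) = F2 F \<beta> \<cdot>\<^bsub>D\<^esub> F2 F \<alpha>"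
    and Fcomp_isos: "\<lbrakk>u \<in> hom C X Y; v \<in> hom C Y Z\<rbrakk> \<Longrightarrow>
      Fcomp F v u \<in> isos D (F1 F v \<odot>\<^bsub>D\<^esub> F1 F u) (F1 F (v \<odot>\<^bsub>C\<^esub> u))"
    and Fcomp_natural: "\<lbrakk>u \<in> hom C X Y; v \<in> hom C Y Z; \<alpha> \<in> cells C u u'; \<beta> \<in> cells C v v'\<rbrakk> \<Longrightarrow>
      Fcomp F v' u' \<cdot>\<^bsub>D\<^esub> (F2 F \<beta> \<star>\<^bsub>D\<^esub> F2 F \<alpha>) = F2 F (\<beta> \<star>\<^bsub>C\<^esub> \<alpha>) \<cdot>\<^bsub>D\<^esub> Fcomp F v u"
    and Funit_isos: "X \<in> Obj C \<Longrightarrow> Funit F X \<in> isos D (id1 D (F0 F X)) (F1 F (id1 C X))"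
    and F_assoc: "\<lbrakk>u \<in> hom C W X; v \<in> hom C X Y; w \<in> hom C Y Z\<rbrakk> \<Longrightarrow>
      F2 F (assoc C w v u) \<cdot>\<^bsub>D\<^esub> Fcomp F (w \<odot>\<^bsub>C\<^esub> v) u \<cdot>\<^bsub>D\<^esub> (Fcomp F w v \<rhd>\<^bsub>D\<^esub> F1 F u) =
      Fcomp F w (v \<odot>\<^bsub>C\<^esub> u) \<cdot>\<^bsub>D\<^esub> (F1 F w \<lhd>\<^bsub>D\<^esub> Fcomp F v u) \<cdot>\<^bsub>D\<^esub> assoc D (F1 F w) (F1 F v) (F1 F u)"
    and F_lunit: "u \<in> hom C X Y \<Longrightarrow>
      F2 F (lunit C u) \<cdot>\<^bsub>D\<^esub> Fcomp F (id1 C Y) u \<cdot>\<^bsub>D\<^esub> (Funit F Y \<rhd>\<^bsub>D\<^esub> F1 F u) = lunit D (F1 F u)"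
    and F_runit: "u \<in> hom C X Y \<Longrightarrow>
      F2 F (runit C u) \<cdot>\<^bsub>D\<^esub> Fcomp F u (id1 C X) \<cdot>\<^bsub>D\<^esub> (F1 F u \<lhd>\<^bsub>D\<^esub> Funit F X) = runit D (F1 F u)"


section \<open>Left extensions\<close>

text \<open>\<open>left_extension D i f f' \<eta>\<close>: the 2-cell \<open>\<eta> : f \<rightarrow> f' \<odot> i\<close> exhibits \<open>f'\<close> as a left extension
  of \<open>f\<close> along \<open>i\<close>.\<close>

definition left_extension ::
    "('o, 'a, 'c) bicat \<Rightarrow> 'a \<Rightarrow> 'a \<Rightarrow> 'a \<Rightarrow> 'c \<Rightarrow> bool"
  where "left_extension D i f f' \<eta> \<longleftrightarrow>
    (\<exists>X X' Y. i \<in> hom D X X' \<and> f \<in> hom D X Y \<and> f' \<in> hom D X' Y \<and>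
      \<eta> \<in> cells D f (f' \<odot>\<^bsub>D\<^esub> i) \<and>
      (\<forall>g \<in> hom D X' Y.
        bij_betw (\<lambda>\<phi>. (\<phi> \<rhd>\<^bsub>D\<^esub> i) \<cdot>\<^bsub>D\<^esub> \<eta>) (cells D f' g) (cells D f (g \<odot>\<^bsub>D\<^esub> i))))"

text \<open>For \<open>f : JX \<rightarrow> TY\<close>, the morphism \<open>f\<^sup>*\<close> is \<open>Star T X Y f\<close> and \<open>\<eta>\<^sub>f\<close> is \<open>Eta T X Y f\<close>: since \<open>J\<close>
  and \<open>T\<close> need not be injective on objects, \<open>X\<close> and \<open>Y\<close> are not determined by \<open>f\<close>.\<close>

record ('p, 'o, 'a, 'c) ext_data =
  TOb :: "'p \<Rightarrow> 'o"
  TI :: "'p \<Rightarrow> 'a"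
  Star :: "'p \<Rightarrow> 'p \<Rightarrow> 'a \<Rightarrow> 'a"
  Eta :: "'p \<Rightarrow> 'p \<Rightarrow> 'a \<Rightarrow> 'c"

locale relative_extension =
  pseudofunctor C D J
  for C :: "('p, 'b, 'e) bicat" and D :: "('o, 'a, 'c) bicat"
    and J :: "('p, 'b, 'e, 'o, 'a, 'c) psfunctor" +
  fixes T :: "('p, 'o, 'a, 'c) ext_data"
  assumes TOb_Obj: "X \<in> Obj C \<Longrightarrow> TOb T X \<in> Obj D"
    and TI_hom: "X \<in> Obj C \<Longrightarrow> TI T X \<in> hom D (F0 J X) (TOb T X)"
    and Star_hom: "\<lbrakk>X \<in> Obj C; Y \<in> Obj C; f \<in> hom D (F0 J X) (TOb T Y)\<rbrakk> \<Longrightarrow>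
      Star T X Y f \<in> hom D (TOb T X) (TOb T Y)"
    and Eta_isos: "\<lbrakk>X \<in> Obj C; Y \<in> Obj C; f \<in> hom D (F0 J X) (TOb T Y)\<rbrakk> \<Longrightarrow>
      Eta T X Y f \<in> isos D f (Star T X Y f \<odot>\<^bsub>D\<^esub> TI T X)"
    and Eta_left_extension: "\<lbrakk>X \<in> Obj C; Y \<in> Obj C; f \<in> hom D (F0 J X) (TOb T Y)\<rbrakk> \<Longrightarrow>
      left_extension D (TI T X) f (Star T X Y f) (Eta T X Y f)"

text \<open>By the universal property of left extensions, \<open>\<phi> \<mapsto> (\<phi> i\<^sub>X) \<cdot> \<eta>\<^sub>f\<close> is the hom-bijection of the
  adjunction \<open>(-)\<^sup>* \<stileturn> (-) i\<^sub>X\<close> with unit \<open>\<eta>\<close>. The counit at \<open>u : TX \<rightarrow> TY\<close> is the 2-cell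
  \<open>(u i\<^sub>X)\<^sup>* \<rightarrow> u\<close> corresponding to the identity on \<open>u i\<^sub>X\<close>.\<close>

definition counit ::
    "('o, 'a, 'c) bicat \<Rightarrow> ('p, 'o, 'a, 'c) ext_data \<Rightarrow> 'p \<Rightarrow> 'p \<Rightarrow> 'a \<Rightarrow> 'c"
  where "counit D T X Y u =
    (THE \<epsilon>. \<epsilon> \<in> cells D (Star T X Y (u \<odot>\<^bsub>D\<^esub> TI T X)) u \<and>
      (\<epsilon> \<rhd>\<^bsub>D\<^esub> TI T X) \<cdot>\<^bsub>D\<^esub> Eta T X Y (u \<odot>\<^bsub>D\<^esub> TI T X) = id2 D (u \<odot>\<^bsub>D\<^esub> TI T X))"

lemma (in relative_extension) counit:
  assumes "X \<in> Obj C" "Y \<in> Obj C" "u \<in> hom D (TOb T X) (TOb T Y)"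
  shows "counit D T X Y u \<in> cells D (Star T X Y (u \<odot>\<^bsub>D\<^esub> TI T X)) u"
    and "(counit D T X Y u \<rhd>\<^bsub>D\<^esub> TI T X) \<cdot>\<^bsub>D\<^esub> Eta T X Y (u \<odot>\<^bsub>D\<^esub> TI T X) = id2 D (u \<odot>\<^bsub>D\<^esub> TI T X)"
proof -
  let ?f = "u \<odot>\<^bsub>D\<^esub> TI T X"
  let ?P = "\<lambda>\<epsilon>. \<epsilon> \<in> cells D (Star T X Y ?f) u \<and>
    (\<epsilon> \<rhd>\<^bsub>D\<^esub> TI T X) \<cdot>\<^bsub>D\<^esub> Eta T X Y ?f = id2 D ?f"
  have f: "?f \<in> hom D (F0 J X) (TOb T Y)"
    using assms TI_hom D.comp1_hom by blast
  have "left_extension D (TI T X) ?f (Star T X Y ?f) (Eta T X Y ?f)"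
    using assms f Eta_left_extension by blast
  moreover have "TI T X \<in> hom D (F0 J X) (TOb T X)"
    using assms TI_hom by blast
  ultimately have bij: "bij_betw (\<lambda>\<phi>. (\<phi> \<rhd>\<^bsub>D\<^esub> TI T X) \<cdot>\<^bsub>D\<^esub> Eta T X Y ?f)
      (cells D (Star T X Y ?f) u) (cells D ?f ?f)"
    using assms(3) f unfolding left_extension_def by (auto simp: hom_def)
  have "id2 D ?f \<in> cells D ?f ?f"
    using f D.id2_cells by (auto simp: hom_def)
  then have "\<exists>!\<epsilon>. ?P \<epsilon>"
    using bij unfolding bij_betw_def inj_on_def image_def by (smt (verit) mem_Collect_eq)
  then have "?P (counit D T X Y u)"
    unfolding counit_def by (rule theI')
  then show "counit D T X Y u \<in> cells D (Star T X Y ?f) u"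
    and "(counit D T X Y u \<rhd>\<^bsub>D\<^esub> TI T X) \<cdot>\<^bsub>D\<^esub> Eta T X Y ?f = id2 D ?f"
    by blast+
qed


section \<open>Relative pseudomonads\<close>

text \<open>\<open>Star2 P X Y\<close> is the action of the functor \<open>(-)\<^sup>* : D[JX, TY] \<rightarrow> D[TX, TY]\<close> on 2-cells, and
  \<open>\<mu>\<^bsub>g,f\<^esub> : (g\<^sup>* f)\<^sup>* \<rightarrow> g\<^sup>* f\<^sup>*\<close> for \<open>f : JX \<rightarrow> TY\<close>, \<open>g : JY \<rightarrow> TZ\<close> is \<open>Mu P X Y Z g f\<close>.\<close>

record ('p, 'o, 'a, 'c) relpsmonad = "('p, 'o, 'a, 'c) ext_data" +
  Star2 :: "'p \<Rightarrow> 'p \<Rightarrow> 'c \<Rightarrow> 'c"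
  Mu :: "'p \<Rightarrow> 'p \<Rightarrow> 'p \<Rightarrow> 'a \<Rightarrow> 'a \<Rightarrow> 'c"
  Theta :: "'p \<Rightarrow> 'c"

locale relative_pseudomonad =
  pseudofunctor C D J
  for C :: "('p, 'b, 'e) bicat" and D :: "('o, 'a, 'c) bicat" (structure)
    and J :: "('p, 'b, 'e, 'o, 'a, 'c) psfunctor" +
  fixes P :: "('p, 'o, 'a, 'c) relpsmonad"
  assumes TOb_Obj: "X \<in> Obj C \<Longrightarrow> TOb P X \<in> Obj D"
    and Star_hom: "\<lbrakk>X \<in> Obj C; Y \<in> Obj C; f \<in> hom D (F0 J X) (TOb P Y)\<rbrakk> \<Longrightarrow>
      Star P X Y f \<in> hom D (TOb P X) (TOb P Y)"
    and Star2_cells: "\<lbrakk>X \<in> Obj C; Y \<in> Obj C; f \<in> hom D (F0 J X) (TOb P Y); \<alpha> \<in> cells D f f'\<rbrakk> \<Longrightarrow>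
      Star2 P X Y \<alpha> \<in> cells D (Star P X Y f) (Star P X Y f')"
    and Star2_id: "\<lbrakk>X \<in> Obj C; Y \<in> Obj C; f \<in> hom D (F0 J X) (TOb P Y)\<rbrakk> \<Longrightarrow>
      Star2 P X Y (id2 D f) = id2 D (Star P X Y f)"
    and Star2_vcomp: "\<lbrakk>X \<in> Obj C; Y \<in> Obj C; f \<in> hom D (F0 J X) (TOb P Y);
      \<alpha> \<in> cells D f f'; \<alpha>' \<in> cells D f' f''\<rbrakk> \<Longrightarrow>
      Star2 P X Y (\<alpha>' \<cdot> \<alpha>) = Star2 P X Y \<alpha>' \<cdot> Star2 P X Y \<alpha>"
    and TI_hom: "X \<in> Obj C \<Longrightarrow> TI P X \<in> hom D (F0 J X) (TOb P X)"
    and Mu_isos: "\<lbrakk>X \<in> Obj C; Y \<in> Obj C; Z \<in> Obj C;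
      f \<in> hom D (F0 J X) (TOb P Y); g \<in> hom D (F0 J Y) (TOb P Z)\<rbrakk> \<Longrightarrow>
      Mu P X Y Z g f \<in> isos D (Star P X Z (Star P Y Z g \<odot> f)) (Star P Y Z g \<odot> Star P X Y f)"
    and Mu_natural: "\<lbrakk>X \<in> Obj C; Y \<in> Obj C; Z \<in> Obj C;
      f \<in> hom D (F0 J X) (TOb P Y); g \<in> hom D (F0 J Y) (TOb P Z);
      \<alpha> \<in> cells D f f'; \<beta> \<in> cells D g g'\<rbrakk> \<Longrightarrow>
      Mu P X Y Z g' f' \<cdot> Star2 P X Z (Star2 P Y Z \<beta> \<star> \<alpha>) =
      (Star2 P Y Z \<beta> \<star> Star2 P X Y \<alpha>) \<cdot> Mu P X Y Z g f"
    and Eta_isos: "\<lbrakk>X \<in> Obj C; Y \<in> Obj C; f \<in> hom D (F0 J X) (TOb P Y)\<rbrakk> \<Longrightarrow>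
      Eta P X Y f \<in> isos D f (Star P X Y f \<odot> TI P X)"
    and Eta_natural: "\<lbrakk>X \<in> Obj C; Y \<in> Obj C; f \<in> hom D (F0 J X) (TOb P Y); \<alpha> \<in> cells D f f'\<rbrakk> \<Longrightarrow>
      Eta P X Y f' \<cdot> \<alpha> = (Star2 P X Y \<alpha> \<rhd> TI P X) \<cdot> Eta P X Y f"
    and Theta_isos: "X \<in> Obj C \<Longrightarrow> Theta P X \<in> isos D (Star P X X (TI P X)) (id1 D (TOb P X))"
    and Mu_assoc: "\<lbrakk>X \<in> Obj C; Y \<in> Obj C; Z \<in> Obj C; V \<in> Obj C; f \<in> hom D (F0 J X) (TOb P Y);
      g \<in> hom D (F0 J Y) (TOb P Z); h \<in> hom D (F0 J Z) (TOb P V)\<rbrakk> \<Longrightarrow>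
      (Star P Z V h \<lhd> Mu P X Y Z g f) \<cdot> Mu P X Z V h (Star P Y Z g \<odot> f) \<cdot>
        Star2 P X V (assoc D (Star P Z V h) (Star P Y Z g) f \<cdot> (Mu P Y Z V h g \<rhd> f)) =
      assoc D (Star P Z V h) (Star P Y Z g) (Star P X Y f) \<cdot>
        (Mu P Y Z V h g \<rhd> Star P X Y f) \<cdot> Mu P X Y V (Star P Z V h \<odot> g) f"
    and Mu_unit: "\<lbrakk>X \<in> Obj C; Y \<in> Obj C; f \<in> hom D (F0 J X) (TOb P Y)\<rbrakk> \<Longrightarrow>
      runit D (Star P X Y f) \<cdot> (Star P X Y f \<lhd> Theta P X) \<cdot>
        Mu P X X Y f (TI P X) \<cdot> Star2 P X Y (Eta P X Y f) = id2 D (Star P X Y f)"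

locale lax_idempotent_relative_pseudomonad =
  relative_pseudomonad C D J P
  for C :: "('p, 'b, 'e) bicat" and D :: "('o, 'a, 'c) bicat" (structure)
    and J :: "('p, 'b, 'e, 'o, 'a, 'c) psfunctor" and P :: "('p, 'o, 'a, 'c) relpsmonad" +
  assumes Eta_left_extension: "\<lbrakk>X \<in> Obj C; Y \<in> Obj C; f \<in> hom D (F0 J X) (TOb P Y)\<rbrakk> \<Longrightarrow>
      left_extension D (TI P X) f (Star P X Y f) (Eta P X Y f)"
    and Mu_Eta: "\<lbrakk>X \<in> Obj C; Y \<in> Obj C; Z \<in> Obj C;
      f \<in> hom D (F0 J X) (TOb P Y); g \<in> hom D (F0 J Y) (TOb P Z)\<rbrakk> \<Longrightarrow>
      assoc D (Star P Y Z g) (Star P X Y f) (TI P X) \<cdot>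
        (Mu P X Y Z g f \<rhd> TI P X) \<cdot> Eta P X Z (Star P Y Z g \<odot> f) =
      Star P Y Z g \<lhd> Eta P X Y f"
    and Theta_Eta: "X \<in> Obj C \<Longrightarrow>
      lunit D (TI P X) \<cdot> (Theta P X \<rhd> TI P X) \<cdot> Eta P X X (TI P X) = id2 D (TI P X)"

locale relative_left_Kan_pseudomonad =
  relative_extension C D J T
  for C :: "('p, 'b, 'e) bicat" and D :: "('o, 'a, 'c) bicat" (structure)
    and J :: "('p, 'b, 'e, 'o, 'a, 'c) psfunctor" and T :: "('p, 'o, 'a, 'c) ext_data" +
  assumes Star_preserves: "\<lbrakk>X \<in> Obj C; Y \<in> Obj C; Z \<in> Obj C;
      f \<in> hom D (F0 J X) (TOb T Y); g \<in> hom D (F0 J Y) (TOb T Z)\<rbrakk> \<Longrightarrow>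
      left_extension D (TI T X) (Star T Y Z g \<odot> f) (Star T Y Z g \<odot> Star T X Y f)
        (inv2 D (assoc D (Star T Y Z g) (Star T X Y f) (TI T X)) \<cdot> (Star T Y Z g \<lhd> Eta T X Y f))"
    and TI_dense: "X \<in> Obj C \<Longrightarrow>
      left_extension D (TI T X) (TI T X) (id1 D (TOb T X)) (inv2 D (lunit D (TI T X)))"


definition all_equivalent :: "bool list \<Rightarrow> bool"
  where "all_equivalent ps \<longleftrightarrow> (\<forall>p \<in> set ps. \<forall>q \<in> set ps. p \<longleftrightarrow> q)"

end

theory Submission
  imports Defs
begin

text \<open>Each \<open>\<eta>\<^sub>f\<close> is invertible, so for \<open>u : TX \<rightarrow> TY\<close> three conditions coincide: the counit
  \<open>\<epsilon>\<^sub>u\<close> is invertible; \<open>u \<cong> f\<^sup>*\<close> for some \<open>f\<close>; the identity of \<open>u i\<^sub>X\<close> exhibits \<open>u\<close> as its own left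
  extension along \<open>i\<^sub>X\<close>. In particular \<open>\<epsilon>\<close> is always invertible at \<open>f\<^sup>*\<close>. Each of (i)--(v) then says
  that this class of morphisms contains the identities \<open>1\<^bsub>TX\<^esub>\<close> and the composites \<open>g\<^sup>* f\<^sup>*\<close>. For (i), the
  structure 2-cells are obtained, and their equations verified, by the universal property of left
  extensions.\<close>

section \<open>Calculus of 2-cells\<close>

text \<open>The coincidence of the three conditions rests on one observation: whether an invertible
  2-cell into \<open>u i\<close> exhibits \<open>u\<close> as a left extension of its domain does
  not depend on that 2-cell, because any two of them differ by an invertible 2-cell between their
  domains. So the associators, unitors and whiskered units that decorate (v) can be traded for an
  identity, and the bare existence of isomorphisms in (ii) already carries the full information.
  Compatible isomorphisms are then recovered as the unique 2-cells that commute with the units.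

  Every equation required of these 2-cells has both sides going out of some \<open>f*\<close>, so it
  may be checked after restriction along \<open>i\<close> and composition with the unit at
  \<open>f\<close>. There the inductively nested stars disappear and only the bookkeeping of
  explicit constraint 2-cells remains, settled by naturality, pentagon and triangle.\<close>

context bicategory
begin

section \<open>Typing rules and vertical composition\<close>

lemma homI: "\<lbrakk>u \<in> Arr B; Src B u = X; Trg B u = Y\<rbrakk> \<Longrightarrow> u \<in> hom B X Y"
  by (simp add: hom_def)

lemma cellsI: "\<lbrakk>\<alpha> \<in> Cell B; Dom B \<alpha> = u; Cod B \<alpha> = v\<rbrakk> \<Longrightarrow> \<alpha> \<in> cells B u v"
  by (simp add: cells_def)

lemma comp1_simps [simp]:
  assumes "u \<in> Arr B" "v \<in> Arr B" "Src B v = Trg B u"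
  shows "v \<odot> u \<in> Arr B" "Src B (v \<odot> u) = Src B u" "Trg B (v \<odot> u) = Trg B v"
  using assms comp1_hom[of u "Src B u" "Trg B u" v "Trg B v"] by (auto simp: hom_def)

lemma Src_Trg_Obj [simp]:
  assumes "u \<in> Arr B"
  shows "Src B u \<in> Obj B" "Trg B u \<in> Obj B"
  using assms src_trg by auto

lemma id1_simps [simp]:
  assumes "X \<in> Obj B"
  shows "id1 B X \<in> Arr B" "Src B (id1 B X) = X" "Trg B (id1 B X) = X"
  using assms id1_hom by (auto simp: hom_def)

lemma Dom_Cod_Arr [simp]:
  assumes "\<alpha> \<in> Cell B"
  shows "Dom B \<alpha> \<in> Arr B" "Cod B \<alpha> \<in> Arr B"
    "Src B (Cod B \<alpha>) = Src B (Dom B \<alpha>)" "Trg B (Cod B \<alpha>) = Trg B (Dom B \<alpha>)"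
  using assms dom_cod by auto

lemma id2_simps [simp]:
  assumes "u \<in> Arr B"
  shows "id2 B u \<in> Cell B" "Dom B (id2 B u) = u" "Cod B (id2 B u) = u"
  using assms id2_cells by (auto simp: cells_def)

lemma vcomp_simps [simp]:
  assumes "\<alpha> \<in> Cell B" "\<beta> \<in> Cell B" "Dom B \<beta> = Cod B \<alpha>"
  shows "\<beta> \<cdot> \<alpha> \<in> Cell B" "Dom B (\<beta> \<cdot> \<alpha>) = Dom B \<alpha>" "Cod B (\<beta> \<cdot> \<alpha>) = Cod B \<beta>"
  using assms vcomp_cells[of \<alpha> "Dom B \<alpha>" "Cod B \<alpha>" \<beta> "Cod B \<beta>"] by (auto simp: cells_def)

lemma vcomp_id2 [simp]:
  assumes "\<alpha> \<in> Cell B"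
  shows "Cod B \<alpha> = u \<Longrightarrow> id2 B u \<cdot> \<alpha> = \<alpha>" "Dom B \<alpha> = u \<Longrightarrow> \<alpha> \<cdot> id2 B u = \<alpha>"
  using assms vcomp_id_left[of \<alpha>] vcomp_id_right[of \<alpha>] by (auto simp: cells_def)

lemma vcomp_assoc' [simp]:
  assumes "\<alpha> \<in> Cell B" "\<beta> \<in> Cell B" "\<gamma> \<in> Cell B"
    "Dom B \<beta> = Cod B \<alpha>" "Dom B \<gamma> = Cod B \<beta>"
  shows "(\<gamma> \<cdot> \<beta>) \<cdot> \<alpha> = \<gamma> \<cdot> \<beta> \<cdot> \<alpha>"
  using assms by (intro vcomp_assoc cellsI) auto

text \<open>Composites are normalised to be right-nested, so a pair at the head of a longer chain is
  not a subterm of it. An equation for the pair is lifted here to the chain.\<close>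

lemma vcomp_rewrite:
  assumes "\<gamma> \<cdot> \<beta> = \<delta>" "\<alpha> \<in> Cell B" "\<beta> \<in> Cell B" "\<gamma> \<in> Cell B"
    "Dom B \<beta> = Cod B \<alpha>" "Dom B \<gamma> = Cod B \<beta>"
  shows "\<gamma> \<cdot> \<beta> \<cdot> \<alpha> = \<delta> \<cdot> \<alpha>"
  using assms vcomp_assoc' by metis

lemma hcomp_simps [simp]:
  assumes "\<alpha> \<in> Cell B" "\<beta> \<in> Cell B" "Src B (Dom B \<beta>) = Trg B (Dom B \<alpha>)"
  shows "\<beta> \<star> \<alpha> \<in> Cell B" "Dom B (\<beta> \<star> \<alpha>) = Dom B \<beta> \<odot> Dom B \<alpha>"
    "Cod B (\<beta> \<star> \<alpha>) = Cod B \<beta> \<odot> Cod B \<alpha>"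
proof -
  have "\<beta> \<star> \<alpha> \<in> cells B (Dom B \<beta> \<odot> Dom B \<alpha>) (Cod B \<beta> \<odot> Cod B \<alpha>)"
    using assms by (intro hcomp_cells homI cellsI) auto
  then show "\<beta> \<star> \<alpha> \<in> Cell B" "Dom B (\<beta> \<star> \<alpha>) = Dom B \<beta> \<odot> Dom B \<alpha>"
    "Cod B (\<beta> \<star> \<alpha>) = Cod B \<beta> \<odot> Cod B \<alpha>"
    by (auto simp: cells_def)
qed

lemma whisker_left_simps [simp]:
  assumes "\<alpha> \<in> Cell B" "v \<in> Arr B" "Src B v = Trg B (Dom B \<alpha>)"
  shows "v \<lhd> \<alpha> \<in> Cell B" "Dom B (v \<lhd> \<alpha>) = v \<odot> Dom B \<alpha>" "Cod B (v \<lhd> \<alpha>) = v \<odot> Cod B \<alpha>"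
  using assms by (auto simp: whisker_left_def)

lemma whisker_right_simps [simp]:
  assumes "\<alpha> \<in> Cell B" "u \<in> Arr B" "Src B (Dom B \<alpha>) = Trg B u"
  shows "\<alpha> \<rhd> u \<in> Cell B" "Dom B (\<alpha> \<rhd> u) = Dom B \<alpha> \<odot> u" "Cod B (\<alpha> \<rhd> u) = Cod B \<alpha> \<odot> u"
  using assms by (auto simp: whisker_right_def)

section \<open>Interchange and whiskering\<close>

lemma interchange':
  assumes "\<alpha> \<in> Cell B" "\<alpha>' \<in> Cell B" "\<beta> \<in> Cell B" "\<beta>' \<in> Cell B"
    "Dom B \<alpha>' = Cod B \<alpha>" "Dom B \<beta>' = Cod B \<beta>" "Src B (Dom B \<beta>) = Trg B (Dom B \<alpha>)"
  shows "(\<beta>' \<cdot> \<beta>) \<star> (\<alpha>' \<cdot> \<alpha>) = (\<beta>' \<star> \<alpha>') \<cdot> (\<beta> \<star> \<alpha>)"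
  using assms by (intro interchange homI cellsI) auto

lemma whisker_left_vcomp [simp]:
  assumes "\<alpha> \<in> Cell B" "\<beta> \<in> Cell B" "v \<in> Arr B" "Dom B \<beta> = Cod B \<alpha>" "Src B v = Trg B (Dom B \<alpha>)"
  shows "v \<lhd> (\<beta> \<cdot> \<alpha>) = (v \<lhd> \<beta>) \<cdot> (v \<lhd> \<alpha>)"
  using assms interchange'[of \<alpha> \<beta> "id2 B v" "id2 B v"] by (simp add: whisker_left_def)

lemma whisker_right_vcomp [simp]:
  assumes "\<alpha> \<in> Cell B" "\<beta> \<in> Cell B" "u \<in> Arr B" "Dom B \<beta> = Cod B \<alpha>" "Src B (Dom B \<alpha>) = Trg B u"
  shows "(\<beta> \<cdot> \<alpha>) \<rhd> u = (\<beta> \<rhd> u) \<cdot> (\<alpha> \<rhd> u)"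
  using assms interchange'[of "id2 B u" "id2 B u" \<alpha> \<beta>] by (simp add: whisker_right_def)

lemma whisker_id2 [simp]:
  assumes "u \<in> Arr B" "v \<in> Arr B" "Src B v = Trg B u"
  shows "v \<lhd> id2 B u = id2 B (v \<odot> u)" "id2 B v \<rhd> u = id2 B (v \<odot> u)"
  using assms hcomp_id by (auto simp: whisker_left_def whisker_right_def hom_def)

lemma hcomp_eq_whiskers:
  assumes "\<alpha> \<in> Cell B" "\<beta> \<in> Cell B" "Src B (Dom B \<beta>) = Trg B (Dom B \<alpha>)"
  shows "\<beta> \<star> \<alpha> = (Cod B \<beta> \<lhd> \<alpha>) \<cdot> (\<beta> \<rhd> Dom B \<alpha>)"
  using assms interchange'[of "id2 B (Dom B \<alpha>)" \<alpha> \<beta> "id2 B (Cod B \<beta>)"]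
  by (simp add: whisker_left_def whisker_right_def)

text \<open>Both sides are \<open>\<beta> \<star> \<alpha>\<close>, split by interchange in the two
  possible orders. The boundaries are variables tied by equations, so that the rule still unifies
  once \<open>Dom\<close> and \<open>Cod\<close> have been evaluated.\<close>

lemma whisker_exchange:
  assumes "\<alpha> \<in> Cell B" "\<beta> \<in> Cell B" "Src B (Dom B \<beta>) = Trg B (Dom B \<alpha>)"
    "Dom B \<alpha> = u" "Cod B \<alpha> = u'" "Dom B \<beta> = v" "Cod B \<beta> = v'"
  shows "(\<beta> \<rhd> u') \<cdot> (v \<lhd> \<alpha>) = (v' \<lhd> \<alpha>) \<cdot> (\<beta> \<rhd> u)"
  using assms(1-3) hcomp_eq_whiskers[of \<alpha> \<beta>] interchange'[of \<alpha> "id2 B (Cod B \<alpha>)" "id2 B (Dom B \<beta>)" \<beta>]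
  unfolding assms(4-7)[symmetric] by (simp add: whisker_left_def whisker_right_def)

section \<open>Inverses of 2-cells and isomorphism of 1-cells\<close>

lemma invertible_inv2:
  assumes "invertible B \<alpha>"
  shows "inverse_cells B \<alpha> (inv2 B \<alpha>)"
proof -
  obtain \<beta> where \<beta>: "inverse_cells B \<alpha> \<beta>"
    using assms by (auto simp: invertible_def)
  have "\<gamma> = \<beta>" if "inverse_cells B \<alpha> \<gamma>" for \<gamma>
  proof -
    have "\<gamma> = \<gamma> \<cdot> \<alpha> \<cdot> \<beta>" "\<gamma> \<cdot> \<alpha> \<cdot> \<beta> = \<beta>"
      using that \<beta> vcomp_assoc'[of \<beta> \<alpha> \<gamma>] by (auto simp: inverse_cells_def cells_def)
    then show ?thesis by simp
  qed
  with \<beta> show ?thesis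
    unfolding inv2_def by (metis theI')
qed

lemma invertible_Cell: "invertible B \<alpha> \<Longrightarrow> \<alpha> \<in> Cell B"
  by (auto simp: invertible_def inverse_cells_def)

lemma inv2_simps [simp]:
  assumes "invertible B \<alpha>"
  shows "inv2 B \<alpha> \<in> Cell B" "Dom B (inv2 B \<alpha>) = Cod B \<alpha>" "Cod B (inv2 B \<alpha>) = Dom B \<alpha>"
    "inv2 B \<alpha> \<cdot> \<alpha> = id2 B (Dom B \<alpha>)" "\<alpha> \<cdot> inv2 B \<alpha> = id2 B (Cod B \<alpha>)"
  using invertible_inv2[OF assms] by (auto simp: inverse_cells_def cells_def)

lemma inv2_cancel [simp]:
  assumes "invertible B \<alpha>" "\<xi> \<in> Cell B"
  shows "Cod B \<xi> = Dom B \<alpha> \<Longrightarrow> inv2 B \<alpha> \<cdot> \<alpha> \<cdot> \<xi> = \<xi>"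
    "Cod B \<xi> = Cod B \<alpha> \<Longrightarrow> \<alpha> \<cdot> inv2 B \<alpha> \<cdot> \<xi> = \<xi>"
  using assms invertible_Cell[OF assms(1)]
  by (simp_all flip: vcomp_assoc')

lemma invertible_cancel_left:
  assumes "invertible B \<gamma>" "\<gamma> \<cdot> \<alpha> = \<gamma> \<cdot> \<beta>" "\<alpha> \<in> Cell B" "\<beta> \<in> Cell B"
    "Cod B \<alpha> = Dom B \<gamma>" "Cod B \<beta> = Dom B \<gamma>"
  shows "\<alpha> = \<beta>"
  by (metis assms inv2_cancel(1))

lemma invertibleI:
  assumes "\<alpha> \<in> Cell B" "\<beta> \<in> Cell B" "Dom B \<beta> = Cod B \<alpha>" "Cod B \<beta> = Dom B \<alpha>"
    "\<beta> \<cdot> \<alpha> = id2 B (Dom B \<alpha>)" "\<alpha> \<cdot> \<beta> = id2 B (Cod B \<alpha>)"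
  shows "invertible B \<alpha>"
  using assms by (auto simp: invertible_def inverse_cells_def cells_def)

lemma invertible_inv2_invertible [simp]: "invertible B \<alpha> \<Longrightarrow> invertible B (inv2 B \<alpha>)"
  by (rule invertibleI[of _ \<alpha>]) (auto simp: invertible_Cell)

lemma invertible_id2 [simp]: "u \<in> Arr B \<Longrightarrow> invertible B (id2 B u)"
  by (rule invertibleI[of _ "id2 B u"]) auto

lemma invertible_vcomp [simp]:
  assumes "invertible B \<alpha>" "invertible B \<beta>" "Dom B \<beta> = Cod B \<alpha>"
  shows "invertible B (\<beta> \<cdot> \<alpha>)"
  using assms by (intro invertibleI[of _ "inv2 B \<alpha> \<cdot> inv2 B \<beta>"]) (auto simp: invertible_Cell)

lemma invertible_hcomp [simp]:
  assumes "invertible B \<alpha>" "invertible B \<beta>" "Src B (Dom B \<beta>) = Trg B (Dom B \<alpha>)"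
  shows "invertible B (\<beta> \<star> \<alpha>)"
proof (rule invertibleI[of _ "inv2 B \<beta> \<star> inv2 B \<alpha>"])
  have [simp]: "\<alpha> \<in> Cell B" "\<beta> \<in> Cell B"
    using assms invertible_Cell by auto
  have id: "id2 B v \<star> id2 B u = id2 B (v \<odot> u)"
    if "u \<in> Arr B" "v \<in> Arr B" "Src B v = Trg B u" for u v
    using that by (intro hcomp_id homI) auto
  show "(inv2 B \<beta> \<star> inv2 B \<alpha>) \<cdot> (\<beta> \<star> \<alpha>) = id2 B (Dom B (\<beta> \<star> \<alpha>))"
    "(\<beta> \<star> \<alpha>) \<cdot> (inv2 B \<beta> \<star> inv2 B \<alpha>) = id2 B (Cod B (\<beta> \<star> \<alpha>))"
    using assms by (simp_all add: id flip: interchange')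
qed (use assms invertible_Cell in auto)

lemma invertible_whisker [simp]:
  assumes "invertible B \<alpha>"
  shows "\<lbrakk>v \<in> Arr B; Src B v = Trg B (Dom B \<alpha>)\<rbrakk> \<Longrightarrow> invertible B (v \<lhd> \<alpha>)"
    "\<lbrakk>u \<in> Arr B; Src B (Dom B \<alpha>) = Trg B u\<rbrakk> \<Longrightarrow> invertible B (\<alpha> \<rhd> u)"
  using assms by (auto simp: whisker_left_def whisker_right_def)

lemma isosI: "\<lbrakk>invertible B \<alpha>; Dom B \<alpha> = u; Cod B \<alpha> = v\<rbrakk> \<Longrightarrow> \<alpha> \<in> isos B u v"
  by (auto simp: isos_def cells_def invertible_Cell)

lemma isosD: "\<alpha> \<in> isos B u v \<Longrightarrow> invertible B \<alpha>" "\<alpha> \<in> isos B u v \<Longrightarrow> \<alpha> \<in> Cell B"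
  "\<alpha> \<in> isos B u v \<Longrightarrow> Dom B \<alpha> = u" "\<alpha> \<in> isos B u v \<Longrightarrow> Cod B \<alpha> = v"
  by (auto simp: isos_def cells_def)

lemma isomorphic_refl: "u \<in> Arr B \<Longrightarrow> isomorphic B u u"
  using isosI[of "id2 B u" u u] by (auto simp: isomorphic_def)

lemma isomorphic_sym: "isomorphic B u v \<Longrightarrow> isomorphic B v u"
  unfolding isomorphic_def by (metis inv2_simps(2,3) invertible_inv2_invertible isosD(1,3,4) isosI)

lemma isomorphic_trans: "isomorphic B u v \<Longrightarrow> isomorphic B v w \<Longrightarrow> isomorphic B u w"
  unfolding isomorphic_def by (metis invertible_vcomp isosD isosI vcomp_simps(2,3))

lemma isomorphic_comp1:
  assumes "isomorphic B u u'" "isomorphic B v v'" "u \<in> hom B X Y" "v \<in> hom B Y Z"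
  shows "isomorphic B (v \<odot> u) (v' \<odot> u')"
proof -
  obtain \<alpha> \<beta> where "\<alpha> \<in> isos B u u'" "\<beta> \<in> isos B v v'"
    using assms by (auto simp: isomorphic_def)
  with assms(3,4) have "\<beta> \<star> \<alpha> \<in> isos B (v \<odot> u) (v' \<odot> u')"
    by (intro isosI) (auto simp: isosD hom_def)
  then show ?thesis
    by (auto simp: isomorphic_def)
qed

section \<open>Constraint 2-cells: naturality and coherence\<close>

lemma assoc_simps [simp]:
  assumes "u \<in> Arr B" "v \<in> Arr B" "w \<in> Arr B" "Src B v = Trg B u" "Src B w = Trg B v"
  shows "assoc B w v u \<in> Cell B" "Dom B (assoc B w v u) = (w \<odot> v) \<odot> u"
    "Cod B (assoc B w v u) = w \<odot> v \<odot> u" "invertible B (assoc B w v u)"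
  using assms isosD[OF assoc_isos[of u _ _ v _ w]] by (auto simp: hom_def)

lemma lunit_simps [simp]:
  assumes "u \<in> Arr B"
  shows "lunit B u \<in> Cell B" "Dom B (lunit B u) = id1 B (Trg B u) \<odot> u"
    "Cod B (lunit B u) = u" "invertible B (lunit B u)"
  using assms isosD[OF lunit_isos[of u]] by (auto simp: hom_def)

lemma runit_simps [simp]:
  assumes "u \<in> Arr B"
  shows "runit B u \<in> Cell B" "Dom B (runit B u) = u \<odot> id1 B (Src B u)"
    "Cod B (runit B u) = u" "invertible B (runit B u)"
  using assms isosD[OF runit_isos[of u]] by (auto simp: hom_def)

lemma isomorphic_runit:
  assumes "u \<in> hom B X Y"
  shows "isomorphic B (u \<odot> id1 B X) u"
  using runit_isos[OF assms] by (auto simp: isomorphic_def)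

lemma assoc_natural':
  assumes "\<alpha> \<in> Cell B" "\<beta> \<in> Cell B" "\<gamma> \<in> Cell B"
    "Src B (Dom B \<beta>) = Trg B (Dom B \<alpha>)" "Src B (Dom B \<gamma>) = Trg B (Dom B \<beta>)"
  shows "assoc B (Cod B \<gamma>) (Cod B \<beta>) (Cod B \<alpha>) \<cdot> ((\<gamma> \<star> \<beta>) \<star> \<alpha>) =
    (\<gamma> \<star> \<beta> \<star> \<alpha>) \<cdot> assoc B (Dom B \<gamma>) (Dom B \<beta>) (Dom B \<alpha>)"
  using assms by (intro assoc_natural homI cellsI) auto

lemma id2_hcomp_id2:
  assumes "u \<in> Arr B" "v \<in> Arr B" "Src B v = Trg B u"
  shows "id2 B v \<star> id2 B u = id2 B (v \<odot> u)"
  using assms by (intro hcomp_id homI) auto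

text \<open>Here and in the next two lemmas, the associator is natural in one variable, with
  identity 2-cells put in the other two.\<close>

lemma assoc_whisker_left:
  assumes "\<alpha> \<in> Cell B" "v \<in> Arr B" "w \<in> Arr B" "Src B v = Trg B (Dom B \<alpha>)" "Src B w = Trg B v"
    "Dom B \<alpha> = u" "Cod B \<alpha> = u'"
  shows "assoc B w v u' \<cdot> ((w \<odot> v) \<lhd> \<alpha>) = (w \<lhd> v \<lhd> \<alpha>) \<cdot> assoc B w v u"
  using assms assoc_natural'[of \<alpha> "id2 B v" "id2 B w"] by (simp add: whisker_left_def id2_hcomp_id2)

lemma assoc_whisker_middle:
  assumes "\<beta> \<in> Cell B" "u \<in> Arr B" "w \<in> Arr B" "Src B (Dom B \<beta>) = Trg B u" "Src B w = Trg B (Dom B \<beta>)"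
    "Dom B \<beta> = v" "Cod B \<beta> = v'"
  shows "assoc B w v' u \<cdot> ((w \<lhd> \<beta>) \<rhd> u) = (w \<lhd> (\<beta> \<rhd> u)) \<cdot> assoc B w v u"
  using assms assoc_natural'[of "id2 B u" \<beta> "id2 B w"]
  by (simp add: whisker_left_def whisker_right_def)

lemma assoc_whisker_right:
  assumes "\<gamma> \<in> Cell B" "u \<in> Arr B" "v \<in> Arr B" "Src B v = Trg B u" "Src B (Dom B \<gamma>) = Trg B v"
    "Dom B \<gamma> = w" "Cod B \<gamma> = w'"
  shows "assoc B w' v u \<cdot> ((\<gamma> \<rhd> v) \<rhd> u) = (\<gamma> \<rhd> (v \<odot> u)) \<cdot> assoc B w v u"
  using assms assoc_natural'[of "id2 B u" "id2 B v" \<gamma>] by (simp add: whisker_right_def id2_hcomp_id2)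

lemma pentagon':
  assumes "u \<in> Arr B" "v \<in> Arr B" "w \<in> Arr B" "x \<in> Arr B"
    "Src B v = Trg B u" "Src B w = Trg B v" "Src B x = Trg B w"
  shows "(x \<lhd> assoc B w v u) \<cdot> assoc B x (w \<odot> v) u \<cdot> (assoc B x w v \<rhd> u) =
    assoc B x w (v \<odot> u) \<cdot> assoc B (x \<odot> w) v u"
  using assms by (intro pentagon homI) auto

end

section \<open>Left extensions and invertible 2-cells\<close>

context bicategory
begin

section \<open>The universal property of a left extension\<close>

lemma left_extensionD:
  assumes "left_extension B i f f' \<eta>"
  shows "i \<in> Arr B" "f \<in> Arr B" "f' \<in> Arr B" "\<eta> \<in> Cell B"
    "Dom B \<eta> = f" "Cod B \<eta> = f' \<odot> i"
    "Src B f = Src B i" "Src B f' = Trg B i" "Trg B f' = Trg B f"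
  using assms by (auto simp: left_extension_def hom_def cells_def)

lemma left_extension_bij:
  assumes "left_extension B i f f' \<eta>" "g \<in> Arr B" "Src B g = Src B f'" "Trg B g = Trg B f'"
  shows "bij_betw (\<lambda>\<phi>. (\<phi> \<rhd> i) \<cdot> \<eta>) (cells B f' g) (cells B f (g \<odot> i))"
  using assms by (auto simp: left_extension_def hom_def)

lemma left_extension_eqI:
  assumes "left_extension B i f f' \<eta>" "\<phi> \<in> Cell B" "\<psi> \<in> Cell B"
    "Dom B \<phi> = f'" "Dom B \<psi> = f'" "Cod B \<phi> = Cod B \<psi>"
    "(\<phi> \<rhd> i) \<cdot> \<eta> = (\<psi> \<rhd> i) \<cdot> \<eta>"
  shows "\<phi> = \<psi>"
proof -
  have "inj_on (\<lambda>\<phi>. (\<phi> \<rhd> i) \<cdot> \<eta>) (cells B f' (Cod B \<psi>))"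
    using left_extension_bij[OF assms(1), of "Cod B \<psi>"] assms by (auto simp: bij_betw_def)
  then show ?thesis
    using assms by (auto simp: inj_on_def cells_def)
qed

lemma left_extension_factor:
  assumes "left_extension B i f f' \<eta>" "g \<in> Arr B" "Src B g = Src B f'" "Trg B g = Trg B f'"
    "\<alpha> \<in> Cell B" "Dom B \<alpha> = f" "Cod B \<alpha> = g \<odot> i"
  obtains \<phi> where "\<phi> \<in> Cell B" "Dom B \<phi> = f'" "Cod B \<phi> = g" "(\<phi> \<rhd> i) \<cdot> \<eta> = \<alpha>"
proof -
  have "\<alpha> \<in> (\<lambda>\<phi>. (\<phi> \<rhd> i) \<cdot> \<eta>) ` cells B f' g"
    using left_extension_bij[OF assms(1-4)] assms(5-7) by (auto simp: bij_betw_def cells_def)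
  then show ?thesis
    using that by (auto simp: cells_def)
qed

text \<open>The inverse of the bijection in a left extension, taken as a function because the
  components of a pseudomonad have to be given as operations.\<close>

definition factor :: "'a \<Rightarrow> 'a \<Rightarrow> 'c \<Rightarrow> 'a \<Rightarrow> 'c \<Rightarrow> 'c"
  where "factor i f' \<eta> g \<alpha> = (THE \<phi>. \<phi> \<in> cells B f' g \<and> (\<phi> \<rhd> i) \<cdot> \<eta> = \<alpha>)"

lemma factor:
  assumes "left_extension B i f f' \<eta>" "g \<in> Arr B" "Src B g = Src B f'" "Trg B g = Trg B f'"
    "\<alpha> \<in> Cell B" "Dom B \<alpha> = f" "Cod B \<alpha> = g \<odot> i"
  shows "factor i f' \<eta> g \<alpha> \<in> Cell B" "Dom B (factor i f' \<eta> g \<alpha>) = f'"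
    "Cod B (factor i f' \<eta> g \<alpha>) = g" "(factor i f' \<eta> g \<alpha> \<rhd> i) \<cdot> \<eta> = \<alpha>"
proof -
  have "\<exists>!\<phi>. \<phi> \<in> cells B f' g \<and> (\<phi> \<rhd> i) \<cdot> \<eta> = \<alpha>"
  proof -
    obtain \<phi> where \<phi>: "\<phi> \<in> cells B f' g \<and> (\<phi> \<rhd> i) \<cdot> \<eta> = \<alpha>"
      by (rule left_extension_factor[OF assms]) (auto simp: cells_def)
    show ?thesis
    proof (rule ex1I, rule \<phi>)
      fix \<psi> assume "\<psi> \<in> cells B f' g \<and> (\<psi> \<rhd> i) \<cdot> \<eta> = \<alpha>"
      with \<phi> show "\<psi> = \<phi>"
        using left_extension_eqI[OF assms(1), of \<psi> \<phi>] by (auto simp: cells_def)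
    qed
  qed
  from theI'[OF this] show "factor i f' \<eta> g \<alpha> \<in> Cell B" "Dom B (factor i f' \<eta> g \<alpha>) = f'"
    "Cod B (factor i f' \<eta> g \<alpha>) = g" "(factor i f' \<eta> g \<alpha> \<rhd> i) \<cdot> \<eta> = \<alpha>"
    by (auto simp: factor_def cells_def)
qed

lemma left_extensionI:
  assumes "i \<in> Arr B" "f \<in> Arr B" "f' \<in> Arr B" "\<eta> \<in> Cell B" "Dom B \<eta> = f" "Cod B \<eta> = f' \<odot> i"
    "Src B f = Src B i" "Src B f' = Trg B i" "Trg B f' = Trg B f"
  and inj: "\<And>\<phi> \<psi>. \<lbrakk>\<phi> \<in> Cell B; \<psi> \<in> Cell B; Dom B \<phi> = f'; Dom B \<psi> = f'; Cod B \<phi> = Cod B \<psi>;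
      (\<phi> \<rhd> i) \<cdot> \<eta> = (\<psi> \<rhd> i) \<cdot> \<eta>\<rbrakk> \<Longrightarrow> \<phi> = \<psi>"
  and surj: "\<And>g \<alpha>. \<lbrakk>g \<in> Arr B; Src B g = Src B f'; Trg B g = Trg B f';
      \<alpha> \<in> Cell B; Dom B \<alpha> = f; Cod B \<alpha> = g \<odot> i\<rbrakk> \<Longrightarrow>
      \<exists>\<phi>. \<phi> \<in> Cell B \<and> Dom B \<phi> = f' \<and> Cod B \<phi> = g \<and> (\<phi> \<rhd> i) \<cdot> \<eta> = \<alpha>"
  shows "left_extension B i f f' \<eta>"
proof -
  have "bij_betw (\<lambda>\<phi>. (\<phi> \<rhd> i) \<cdot> \<eta>) (cells B f' g) (cells B f (g \<odot> i))"
    if g: "g \<in> hom B (Trg B i) (Trg B f)" for g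
    unfolding bij_betw_def
  proof (intro conjI inj_onI equalityI subsetI)
    fix \<phi> \<psi> assume "\<phi> \<in> cells B f' g" "\<psi> \<in> cells B f' g" "(\<phi> \<rhd> i) \<cdot> \<eta> = (\<psi> \<rhd> i) \<cdot> \<eta>"
    then show "\<phi> = \<psi>"
      using inj[of \<phi> \<psi>] by (auto simp: cells_def)
  next
    fix \<alpha> assume "\<alpha> \<in> (\<lambda>\<phi>. (\<phi> \<rhd> i) \<cdot> \<eta>) ` cells B f' g"
    then show "\<alpha> \<in> cells B f (g \<odot> i)"
      using assms(1-9) by (auto simp: cells_def)
  next
    fix \<alpha> assume "\<alpha> \<in> cells B f (g \<odot> i)"
    then show "\<alpha> \<in> (\<lambda>\<phi>. (\<phi> \<rhd> i) \<cdot> \<eta>) ` cells B f' g"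
      using surj[of g \<alpha>] g assms(1-9) by (force simp: cells_def hom_def)
  qed
  then show ?thesis
    unfolding left_extension_def using assms(1-9)
    by (intro exI[of _ "Src B i"] exI[of _ "Trg B i"] exI[of _ "Trg B f"])
      (auto simp: hom_def cells_def)
qed

text \<open>Composing with \<open>\<alpha>\<close> is a bijection from 2-cells
  \<open>f -> g i\<close> to 2-cells \<open>Dom B \<alpha> -> g i\<close>, and it carries one
  universal property to the other.\<close>

lemma left_extension_precomp_iso:
  assumes ext: "left_extension B i f f' \<eta>" and \<alpha>: "invertible B \<alpha>" "Cod B \<alpha> = f"
  shows "left_extension B i (Dom B \<alpha>) f' (\<eta> \<cdot> \<alpha>)"
proof (rule left_extensionI)
  note [simp] = left_extensionD[OF ext] \<alpha> invertible_Cell[OF \<alpha>(1)]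
  have "Src B (Dom B \<alpha>) = Src B (Cod B \<alpha>)" "Trg B (Dom B \<alpha>) = Trg B (Cod B \<alpha>)"
    using dom_cod[of \<alpha>] by simp_all
  then have [simp]: "Src B (Dom B \<alpha>) = Src B i" "Trg B (Dom B \<alpha>) = Trg B f"
    by simp_all
  show "i \<in> Arr B" "Dom B \<alpha> \<in> Arr B" "f' \<in> Arr B" "\<eta> \<cdot> \<alpha> \<in> Cell B" "Dom B (\<eta> \<cdot> \<alpha>) = Dom B \<alpha>"
    "Cod B (\<eta> \<cdot> \<alpha>) = f' \<odot> i" "Src B (Dom B \<alpha>) = Src B i" "Src B f' = Trg B i"
    "Trg B f' = Trg B (Dom B \<alpha>)"
    by simp_all
  have cancel: "((\<phi> \<rhd> i) \<cdot> \<eta> \<cdot> \<alpha>) \<cdot> inv2 B \<alpha> = (\<phi> \<rhd> i) \<cdot> \<eta>"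
    if "\<phi> \<in> Cell B" "Dom B \<phi> = f'" for \<phi>
    using that by simp
  show "\<phi> = \<psi>" if "\<phi> \<in> Cell B" "\<psi> \<in> Cell B" "Dom B \<phi> = f'" "Dom B \<psi> = f'"
    "Cod B \<phi> = Cod B \<psi>" "(\<phi> \<rhd> i) \<cdot> \<eta> \<cdot> \<alpha> = (\<psi> \<rhd> i) \<cdot> \<eta> \<cdot> \<alpha>" for \<phi> \<psi>
    using left_extension_eqI[OF ext] that cancel by metis
  show "\<exists>\<phi>. \<phi> \<in> Cell B \<and> Dom B \<phi> = f' \<and> Cod B \<phi> = g \<and> (\<phi> \<rhd> i) \<cdot> \<eta> \<cdot> \<alpha> = \<beta>"
    if g: "g \<in> Arr B" "Src B g = Src B f'" "Trg B g = Trg B f'"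
      "\<beta> \<in> Cell B" "Dom B \<beta> = Dom B \<alpha>" "Cod B \<beta> = g \<odot> i" for g \<beta>
  proof -
    obtain \<phi> where \<phi>: "\<phi> \<in> Cell B" "Dom B \<phi> = f'" "Cod B \<phi> = g" "(\<phi> \<rhd> i) \<cdot> \<eta> = \<beta> \<cdot> inv2 B \<alpha>"
      by (rule left_extension_factor[OF ext, of g "\<beta> \<cdot> inv2 B \<alpha>"]) (use g in auto)
    have "(\<phi> \<rhd> i) \<cdot> \<eta> \<cdot> \<alpha> = (\<beta> \<cdot> inv2 B \<alpha>) \<cdot> \<alpha>"
      using \<phi> by (intro vcomp_rewrite) auto
    also have "\<dots> = \<beta>"
      using g by simp
    finally show ?thesis
      using \<phi> by blast
  qed
qed

text \<open>Since whiskering preserves composition, a 2-cell \<open>\<phi>\<close> out of the new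
  extension restricts to what \<open>\<phi> \<cdot> \<sigma>\<close> restricts to; and
  \<open>\<phi>\<close> is recovered from \<open>\<phi> \<cdot> \<sigma>\<close> by the inverse of
  \<open>\<sigma>\<close>.\<close>

lemma left_extension_postcomp_iso:
  assumes ext: "left_extension B i f f' \<eta>" and \<sigma>: "invertible B \<sigma>" "Dom B \<sigma> = f'"
  shows "left_extension B i f (Cod B \<sigma>) ((\<sigma> \<rhd> i) \<cdot> \<eta>)"
proof (rule left_extensionI)
  note [simp] = left_extensionD[OF ext] \<sigma> invertible_Cell[OF \<sigma>(1)]
  show "i \<in> Arr B" "f \<in> Arr B" "Cod B \<sigma> \<in> Arr B" "(\<sigma> \<rhd> i) \<cdot> \<eta> \<in> Cell B"
    "Dom B ((\<sigma> \<rhd> i) \<cdot> \<eta>) = f" "Cod B ((\<sigma> \<rhd> i) \<cdot> \<eta>) = Cod B \<sigma> \<odot> i"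
    "Src B f = Src B i" "Src B (Cod B \<sigma>) = Trg B i" "Trg B (Cod B \<sigma>) = Trg B f"
    by simp_all
  have comp: "(\<phi> \<rhd> i) \<cdot> (\<sigma> \<rhd> i) \<cdot> \<eta> = ((\<phi> \<cdot> \<sigma>) \<rhd> i) \<cdot> \<eta>"
    if "\<phi> \<in> Cell B" "Dom B \<phi> = Cod B \<sigma>" for \<phi>
    using that by simp
  have cancel: "(\<phi> \<cdot> \<sigma>) \<cdot> inv2 B \<sigma> = \<phi>" if "\<phi> \<in> Cell B" "Dom B \<phi> = Cod B \<sigma>" for \<phi>
    using that by simp
  show "\<phi> = \<psi>" if "\<phi> \<in> Cell B" "\<psi> \<in> Cell B" "Dom B \<phi> = Cod B \<sigma>" "Dom B \<psi> = Cod B \<sigma>"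
    "Cod B \<phi> = Cod B \<psi>" "(\<phi> \<rhd> i) \<cdot> (\<sigma> \<rhd> i) \<cdot> \<eta> = (\<psi> \<rhd> i) \<cdot> (\<sigma> \<rhd> i) \<cdot> \<eta>" for \<phi> \<psi>
  proof -
    have "\<phi> \<cdot> \<sigma> = \<psi> \<cdot> \<sigma>"
      by (rule left_extension_eqI[OF ext])
        (use that(1-5) that(6)[unfolded comp[OF that(1,3)] comp[OF that(2,4)]] in simp_all)
    then show ?thesis
      using cancel that by metis
  qed
  show "\<exists>\<phi>. \<phi> \<in> Cell B \<and> Dom B \<phi> = Cod B \<sigma> \<and> Cod B \<phi> = g \<and> (\<phi> \<rhd> i) \<cdot> (\<sigma> \<rhd> i) \<cdot> \<eta> = \<alpha>"
    if g: "g \<in> Arr B" "Src B g = Src B (Cod B \<sigma>)" "Trg B g = Trg B (Cod B \<sigma>)"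
      "\<alpha> \<in> Cell B" "Dom B \<alpha> = f" "Cod B \<alpha> = g \<odot> i" for g \<alpha>
  proof -
    obtain \<phi> where \<phi>: "\<phi> \<in> Cell B" "Dom B \<phi> = f'" "Cod B \<phi> = g" "(\<phi> \<rhd> i) \<cdot> \<eta> = \<alpha>"
      by (rule left_extension_factor[OF ext, of g \<alpha>]) (use g in auto)
    then have "((\<phi> \<cdot> inv2 B \<sigma>) \<rhd> i) \<cdot> (\<sigma> \<rhd> i) \<cdot> \<eta> = \<alpha>"
      by (subst comp) simp_all
    with \<phi> show ?thesis
      by (intro exI[of _ "\<phi> \<cdot> inv2 B \<sigma>"]) simp
  qed
qed

text \<open>Factoring \<open>\<eta>\<close> through \<open>\<kappa>\<close> gives a 2-cell in the
  other direction. Each of the two composites restricts to the same 2-cell as an identity and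
  therefore equals it.\<close>

lemma left_extension_comparison_invertible:
  assumes ext: "left_extension B i f f' \<eta>" and ext': "left_extension B i f f'' \<kappa>"
    and \<phi>: "\<phi> \<in> Cell B" "Dom B \<phi> = f'" "Cod B \<phi> = f''" "(\<phi> \<rhd> i) \<cdot> \<eta> = \<kappa>"
  shows "invertible B \<phi>"
proof -
  note [simp] = left_extensionD[OF ext] left_extensionD[OF ext'] \<phi>(1-3)
  obtain \<psi> where \<psi>: "\<psi> \<in> Cell B" "Dom B \<psi> = f''" "Cod B \<psi> = f'" "(\<psi> \<rhd> i) \<cdot> \<kappa> = \<eta>"
    by (rule left_extension_factor[OF ext', of f' \<eta>]) auto
  have "\<psi> \<cdot> \<phi> = id2 B f'"
    by (rule left_extension_eqI[OF ext]) (use \<phi>(4) \<psi> in simp_all)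
  moreover have "\<phi> \<cdot> \<psi> = id2 B f''"
    by (rule left_extension_eqI[OF ext']) (use \<phi>(4) \<psi> in simp_all)
  ultimately show ?thesis
    using \<psi> by (intro invertibleI[of _ \<psi>]) simp_all
qed

lemma left_extension_isomorphic:
  assumes "left_extension B i f f' \<eta>" "left_extension B i f f'' \<kappa>"
  shows "isomorphic B f' f''"
proof -
  obtain \<phi> where \<phi>: "\<phi> \<in> Cell B" "Dom B \<phi> = f'" "Cod B \<phi> = f''" "(\<phi> \<rhd> i) \<cdot> \<eta> = \<kappa>"
    by (rule left_extension_factor[OF assms(1), of f'' \<kappa>])
      (use left_extensionD[OF assms(1)] left_extensionD[OF assms(2)] in auto)
  then have "invertible B \<phi>"
    using assms by (intro left_extension_comparison_invertible)
  with \<phi> show ?thesis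
    by (auto simp: isomorphic_def intro: isosI)
qed

section \<open>Morphisms that are their own left extension\<close>

definition self_extending :: "'a \<Rightarrow> 'a \<Rightarrow> bool"
  where "self_extending i u \<longleftrightarrow> left_extension B i (u \<odot> i) u (id2 B (u \<odot> i))"

text \<open>Precomposing the identity with \<open>\<eta>\<close>, or \<open>\<eta>\<close> with its
  inverse, passes from one side to the other. This reduces statements about particular unit 2-cells
  to a property of the 1-cell \<open>u\<close>.\<close>

lemma left_extension_iff_self_extending:
  assumes "invertible B \<eta>" "Cod B \<eta> = u \<odot> i" "i \<in> hom B X Y" "u \<in> hom B Y Z"
  shows "left_extension B i (Dom B \<eta>) u \<eta> \<longleftrightarrow> self_extending i u"
proof
  note [simp] = assms(1,2) invertible_Cell[OF assms(1)]
  have [simp]: "i \<in> Arr B" "u \<in> Arr B" "Src B u = Trg B i"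
    using assms(3,4) by (auto simp: hom_def)
  assume "left_extension B i (Dom B \<eta>) u \<eta>"
  from left_extension_precomp_iso[OF this, of "inv2 B \<eta>"] show "self_extending i u"
    by (simp add: self_extending_def)
next
  note [simp] = assms(1,2) invertible_Cell[OF assms(1)]
  assume "self_extending i u"
  from left_extension_precomp_iso[OF this[unfolded self_extending_def], of \<eta>]
  show "left_extension B i (Dom B \<eta>) u \<eta>"
    by simp
qed

text \<open>Transporting the identity along \<open>\<sigma>\<close> leaves the 2-cell
  \<open>\<sigma> \<rhd> i\<close>, which is invertible, so the preceding criterion applies to
  \<open>v\<close>.\<close>

lemma self_extending_isomorphic:
  assumes "self_extending i u" "isomorphic B u v"
  shows "self_extending i v"
proof -
  obtain \<sigma> where "\<sigma> \<in> isos B u v"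
    using assms(2) by (auto simp: isomorphic_def)
  then have [simp]: "invertible B \<sigma>" "\<sigma> \<in> Cell B" "Dom B \<sigma> = u" "Cod B \<sigma> = v"
    by (auto simp: isosD)
  have ext: "left_extension B i (u \<odot> i) u (id2 B (u \<odot> i))"
    using assms(1) by (simp add: self_extending_def)
  note [simp] = left_extensionD(1,3,8)[OF ext]
  have [simp]: "v \<in> Arr B" "Src B v = Src B u" "Trg B v = Trg B u"
    using Dom_Cod_Arr[of \<sigma>] by simp_all
  have "left_extension B i (Dom B (\<sigma> \<rhd> i)) v (\<sigma> \<rhd> i)"
    using left_extension_postcomp_iso[OF ext, of \<sigma>] by simp
  then show ?thesis
    by (subst (asm) left_extension_iff_self_extending[of _ _ _ "Src B i" "Trg B i" "Trg B v"])
      (simp_all add: hom_def)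
qed

text \<open>All equations are inherited. The content lies in membership: composites stay in
  \<open>A\<close>, and constraint 2-cells must be invertible inside the smaller bicategory.\<close>

lemma full_sub_bicategory:
  assumes A: "A \<subseteq> Arr B" and O: "Obj' \<subseteq> Obj B"
    and src_trg: "\<And>u. u \<in> A \<Longrightarrow> Src B u \<in> Obj' \<and> Trg B u \<in> Obj'"
    and id1: "\<And>X. X \<in> Obj' \<Longrightarrow> id1 B X \<in> A"
    and comp1: "\<And>u v. \<lbrakk>u \<in> A; v \<in> A; Src B v = Trg B u\<rbrakk> \<Longrightarrow> v \<odot> u \<in> A"
  shows "sub_bicategory (B\<lparr>Obj := Obj', Arr := A,
    Cell := {\<alpha> \<in> Cell B. Dom B \<alpha> \<in> A \<and> Cod B \<alpha> \<in> A}\<rparr>) B" (is "sub_bicategory ?E B")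
proof -
  have [simp]: "hom ?E = (\<lambda>X Y. hom B X Y \<inter> A)" 
    using A by (auto simp: hom_def fun_eq_iff)
  have [simp]: "cells ?E u v = (if u \<in> A \<and> v \<in> A then cells B u v else {})" for u v
    by (auto simp: cells_def)
  \<comment> \<open>By fullness the inverse belongs to the sub-bicategory, since its boundary is
    again in \<open>A\<close>.\<close>
  have inv: "invertible ?E \<alpha>" if "invertible B \<alpha>" "Dom B \<alpha> \<in> A" "Cod B \<alpha> \<in> A" for \<alpha>
    using that by (auto simp: invertible_def inverse_cells_def cells_def)
  have isos: "isos B u v \<subseteq> isos ?E u v" if "u \<in> A" "v \<in> A" for u v
    using that inv by (auto simp: isos_def cells_def)
  have [simp]: "whisker_left ?E = whisker_left B" "whisker_right ?E = whisker_right B"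
    by (auto simp: whisker_left_def whisker_right_def fun_eq_iff)
  have c: "v \<odot> u \<in> A" if "u \<in> hom B X Y" "v \<in> hom B Y Z" "u \<in> A" "v \<in> A" for u v X Y Z
    using that comp1 by (auto simp: hom_def)
  have h: "v \<in> hom B X Y" if "u \<in> hom B X Y" "\<alpha> \<in> cells B u v" for u v X Y \<alpha>
    using that Dom_Cod_Arr[of \<alpha>] by (auto simp: hom_def cells_def)
  have "bicategory ?E"
  \<comment> \<open>The cases follow the order of the axioms of \<open>bicategory\<close>.\<close>
  proof (rule bicategory.intro, goal_cases)
    case 1 then show ?case using src_trg by simp
  next
    case 2 then show ?case using dom_cod by simp
  next
    case 3 then show ?case using id1 O id1_hom by auto
  next
    case 4 then show ?case using c comp1_hom by auto
  next
    case 5 then show ?case using A id2_cells by auto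
  next
    case 6 then show ?case using vcomp_cells by (auto split: if_splits)
  next
    case 7 then show ?case using vcomp_id_left by (auto split: if_splits)
  next
    case 8 then show ?case using vcomp_id_right by (auto split: if_splits)
  next
    case 9 then show ?case using vcomp_assoc by (auto split: if_splits)
  next
    case (10 u X Y v Z \<alpha> u' \<beta> v')
    then show ?case
      using hcomp_cells c[of u X Y v Z] c[of u' X Y v' Z] h[of u X Y \<alpha> u'] h[of v Y Z \<beta> v']
      by (auto split: if_splits)
  next
    case 11 then show ?case using hcomp_id by auto
  next
    case 12 then show ?case using interchange by (auto split: if_splits)
  next
    case (13 u W X v Y w Z)
    then have "(w \<odot> v) \<odot> u \<in> A" "w \<odot> v \<odot> u \<in> A"
      using c[of u W X v Y] c[of v X Y w Z] c[of u W X "w \<odot> v" Z] c[of "v \<odot> u" W Y w Z]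
        comp1_hom[of u W X v Y] comp1_hom[of v X Y w Z] by auto
    with 13 show ?case
      using assoc_isos by (auto intro!: isos[THEN subsetD])
  next
    case 14 then show ?case using assoc_natural by (auto split: if_splits)
  next
    case (15 u X Y) 
    then have "id1 B Y \<in> A" "id1 B Y \<in> hom B Y Y"
      using src_trg[of u] id1 id1_hom O by (auto simp: hom_def)
    with 15 show ?case
      using lunit_isos c by (auto intro!: isos[THEN subsetD])
  next
    case 16 then show ?case using lunit_natural by (auto split: if_splits)
  next
    case (17 u X Y) 
    then have "id1 B X \<in> A" "id1 B X \<in> hom B X X"
      using src_trg[of u] id1 id1_hom O by (auto simp: hom_def)
    with 17 show ?case
      using runit_isos c by (auto intro!: isos[THEN subsetD])
  next
    case 18 then show ?case using runit_natural by (auto split: if_splits)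
  next
    case 19 then show ?case using pentagon by auto
  next
    case 20 then show ?case using triangle by auto
  qed
  then show ?thesis
    using A O by (simp add: sub_bicategory_def)
qed

end

section \<open>Morphisms isomorphic to an extension\<close>

context relative_extension
begin

lemma TI_simps [simp]:
  assumes "X \<in> Obj C"
  shows "TI T X \<in> Arr D" "Src D (TI T X) = F0 J X" "Trg D (TI T X) = TOb T X"
  using TI_hom[OF assms] by (auto simp: hom_def)

lemma TOb_simp [simp]: "X \<in> Obj C \<Longrightarrow> TOb T X \<in> Obj D"
  by (rule TOb_Obj)

lemma Star_Eta_simps [simp]:
  assumes "X \<in> Obj C" "Y \<in> Obj C" "f \<in> Arr D" "Src D f = F0 J X" "Trg D f = TOb T Y"
  shows "Star T X Y f \<in> Arr D" "Src D (Star T X Y f) = TOb T X" "Trg D (Star T X Y f) = TOb T Y"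
    "Eta T X Y f \<in> Cell D" "Dom D (Eta T X Y f) = f" "Cod D (Eta T X Y f) = Star T X Y f \<odot>\<^bsub>D\<^esub> TI T X"
    "invertible D (Eta T X Y f)" "left_extension D (TI T X) f (Star T X Y f) (Eta T X Y f)"
  using assms Star_hom[of X Y f] D.isosD[OF Eta_isos[of X Y f]] Eta_left_extension[of X Y f]
  by (auto simp: hom_def)

lemma self_extending_Star:
  assumes "X \<in> Obj C" "Y \<in> Obj C" "f \<in> hom D (F0 J X) (TOb T Y)"
  shows "D.self_extending (TI T X) (Star T X Y f)"
  using assms
    D.left_extension_iff_self_extending[of "Eta T X Y f" "Star T X Y f" "TI T X" "F0 J X" "TOb T X" "TOb T Y"]
  by (simp add: hom_def)

text \<open>The counit at \<open>u\<close> is the comparison from the chosen extension of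
  \<open>u i\<close> to \<open>u\<close> equipped with the identity. If the latter is an extension
  too, the comparison is invertible; conversely, an invertible counit makes \<open>u\<close>
  isomorphic to a chosen extension, which is self-extending.\<close>

lemma invertible_counit_iff:
  assumes "X \<in> Obj C" "Y \<in> Obj C" "u \<in> hom D (TOb T X) (TOb T Y)"
  shows "invertible D (counit D T X Y u) \<longleftrightarrow> D.self_extending (TI T X) u"
proof
  have f: "u \<odot>\<^bsub>D\<^esub> TI T X \<in> hom D (F0 J X) (TOb T Y)"
    using assms by (simp add: hom_def)
  note \<epsilon> = counit[OF assms]
  show "D.self_extending (TI T X) u" if "invertible D (counit D T X Y u)"
  proof (rule D.self_extending_isomorphic)
    show "D.self_extending (TI T X) (Star T X Y (u \<odot>\<^bsub>D\<^esub> TI T X))"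
      by (rule self_extending_Star[OF assms(1,2) f])
    show "isomorphic D (Star T X Y (u \<odot>\<^bsub>D\<^esub> TI T X)) u"
      using that \<epsilon> by (auto simp: isomorphic_def isos_def)
  qed
  show "invertible D (counit D T X Y u)" if "D.self_extending (TI T X) u"
    using \<epsilon> that Eta_left_extension[OF assms(1,2) f]
    by (intro D.left_extension_comparison_invertible[of "TI T X" _ _ "Eta T X Y (u \<odot>\<^bsub>D\<^esub> TI T X)"
          u "id2 D (u \<odot>\<^bsub>D\<^esub> TI T X)"]) (auto simp: D.self_extending_def cells_def)
qed

text \<open>The witness for \<open>f\<close> is \<open>u i\<close>, and the isomorphism is the
  inverse of the counit at \<open>u\<close>.\<close>

lemma self_extending_iff_isomorphic_Star:
  assumes "X \<in> Obj C" "Y \<in> Obj C" "u \<in> hom D (TOb T X) (TOb T Y)"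
  shows "D.self_extending (TI T X) u \<longleftrightarrow>
    (\<exists>f \<in> hom D (F0 J X) (TOb T Y). isomorphic D u (Star T X Y f))"
proof
  assume "D.self_extending (TI T X) u"
  then have "invertible D (counit D T X Y u)"
    using invertible_counit_iff[OF assms] by simp
  then have "isomorphic D (Star T X Y (u \<odot>\<^bsub>D\<^esub> TI T X)) u"
    using counit(1)[OF assms] by (auto simp: isomorphic_def isos_def)
  then have "isomorphic D u (Star T X Y (u \<odot>\<^bsub>D\<^esub> TI T X))"
    by (rule D.isomorphic_sym)
  moreover have "u \<odot>\<^bsub>D\<^esub> TI T X \<in> hom D (F0 J X) (TOb T Y)"
    using assms by (simp add: hom_def)
  ultimately show "\<exists>f \<in> hom D (F0 J X) (TOb T Y). isomorphic D u (Star T X Y f)"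
    by blast
next
  assume "\<exists>f \<in> hom D (F0 J X) (TOb T Y). isomorphic D u (Star T X Y f)"
  then show "D.self_extending (TI T X) u"
    using self_extending_Star[OF assms(1,2)] D.self_extending_isomorphic D.isomorphic_sym by blast
qed

text \<open>Only the chosen extensions are composed here. Composites of arbitrary members of the
  class are covered because self-extension is invariant under isomorphism.\<close>

definition closed_under_extension :: bool
  where "closed_under_extension \<longleftrightarrow>
    (\<forall>X \<in> Obj C. D.self_extending (TI T X) (id1 D (TOb T X))) \<and>
    (\<forall>X \<in> Obj C. \<forall>Y \<in> Obj C. \<forall>Z \<in> Obj C.
      \<forall>f \<in> hom D (F0 J X) (TOb T Y). \<forall>g \<in> hom D (F0 J Y) (TOb T Z).
      D.self_extending (TI T X) (Star T Y Z g \<odot>\<^bsub>D\<^esub> Star T X Y f))"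

lemma id1_left_extension_iff:
  assumes "X \<in> Obj C"
  shows "left_extension D (TI T X) (TI T X) (id1 D (TOb T X)) (inv2 D (lunit D (TI T X))) \<longleftrightarrow>
    D.self_extending (TI T X) (id1 D (TOb T X))"
  using assms D.left_extension_iff_self_extending[of "inv2 D (lunit D (TI T X))" "id1 D (TOb T X)"
      "TI T X" "F0 J X" "TOb T X" "TOb T X"] by (simp add: hom_def)

text \<open>The displayed 2-cell is invertible because the unit at \<open>f\<close> is, and
  whiskering preserves invertibility; so only its codomain matters.\<close>

lemma comp_Star_left_extension_iff:
  assumes "X \<in> Obj C" "Y \<in> Obj C" "Z \<in> Obj C"
    "f \<in> hom D (F0 J X) (TOb T Y)" "g \<in> hom D (F0 J Y) (TOb T Z)"
  shows "left_extension D (TI T X) (Star T Y Z g \<odot>\<^bsub>D\<^esub> f) (Star T Y Z g \<odot>\<^bsub>D\<^esub> Star T X Y f)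
      (inv2 D (assoc D (Star T Y Z g) (Star T X Y f) (TI T X)) \<cdot>\<^bsub>D\<^esub> (Star T Y Z g \<lhd>\<^bsub>D\<^esub> Eta T X Y f)) \<longleftrightarrow>
    D.self_extending (TI T X) (Star T Y Z g \<odot>\<^bsub>D\<^esub> Star T X Y f)"
  using assms D.left_extension_iff_self_extending[of
      "inv2 D (assoc D (Star T Y Z g) (Star T X Y f) (TI T X)) \<cdot>\<^bsub>D\<^esub> (Star T Y Z g \<lhd>\<^bsub>D\<^esub> Eta T X Y f)"
      "Star T Y Z g \<odot>\<^bsub>D\<^esub> Star T X Y f" "TI T X" "F0 J X" "TOb T X" "TOb T Z"]
  by (simp add: hom_def)

text \<open>In each clause the first morphism is the chosen extension of the very 1-cell that the
  second one should extend. Uniqueness of extensions gives an isomorphism; conversely,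
  self-extension of the first passes along any isomorphism to the second.\<close>

lemma closed_under_extension_iff_isomorphic:
  "closed_under_extension \<longleftrightarrow>
    (\<forall>X \<in> Obj C. \<forall>Y \<in> Obj C. \<forall>Z \<in> Obj C.
      \<forall>f \<in> hom D (F0 J X) (TOb T Y). \<forall>g \<in> hom D (F0 J Y) (TOb T Z).
      isomorphic D (Star T X Z (Star T Y Z g \<odot>\<^bsub>D\<^esub> f)) (Star T Y Z g \<odot>\<^bsub>D\<^esub> Star T X Y f)) \<and>
    (\<forall>X \<in> Obj C. isomorphic D (Star T X X (TI T X)) (id1 D (TOb T X)))"
proof -
  have "isomorphic D (Star T X X (TI T X)) (id1 D (TOb T X)) \<longleftrightarrow>
      D.self_extending (TI T X) (id1 D (TOb T X))" if X: "X \<in> Obj C" for X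
    using D.self_extending_isomorphic[OF self_extending_Star[OF X X TI_hom[OF X]]]
      D.left_extension_isomorphic[OF Eta_left_extension[OF X X TI_hom[OF X]]]
      id1_left_extension_iff[OF X] by blast
  moreover have "isomorphic D (Star T X Z (Star T Y Z g \<odot>\<^bsub>D\<^esub> f)) (Star T Y Z g \<odot>\<^bsub>D\<^esub> Star T X Y f) \<longleftrightarrow>
      D.self_extending (TI T X) (Star T Y Z g \<odot>\<^bsub>D\<^esub> Star T X Y f)"
    if X: "X \<in> Obj C" "Y \<in> Obj C" "Z \<in> Obj C"
      "f \<in> hom D (F0 J X) (TOb T Y)" "g \<in> hom D (F0 J Y) (TOb T Z)" for X Y Z f g
  proof -
    have gf: "Star T Y Z g \<odot>\<^bsub>D\<^esub> f \<in> hom D (F0 J X) (TOb T Z)"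
      using X by (simp add: hom_def)
    show ?thesis
      using D.self_extending_isomorphic[OF self_extending_Star[OF X(1,3) gf]]
        D.left_extension_isomorphic[OF Eta_left_extension[OF X(1,3) gf]]
        comp_Star_left_extension_iff[OF X] by blast
  qed
  ultimately show ?thesis
    unfolding closed_under_extension_def by auto
qed

lemma relative_left_Kan_pseudomonad_iff:
  "relative_left_Kan_pseudomonad C D J T \<longleftrightarrow> closed_under_extension"
  using relative_extension_axioms id1_left_extension_iff comp_Star_left_extension_iff
  unfolding closed_under_extension_def relative_left_Kan_pseudomonad_def
    relative_left_Kan_pseudomonad_axioms_def by auto

text \<open>Since \<open>T\<close> need not be injective on objects, membership of \<open>u\<close> in the class must not depend on
  the \<open>X\<close> chosen to present its source; otherwise the hom-categories in (iii) would be ill-defined.\<close>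

lemma self_extending_along_other:
  assumes closed: "closed_under_extension" and X: "X \<in> Obj C" "X' \<in> Obj C" "TOb T X = TOb T X'" and Y: "Y \<in> Obj C"
    and u: "u \<in> hom D (TOb T X) (TOb T Y)" "D.self_extending (TI T X) u"
  shows "D.self_extending (TI T X') u"
proof -
  obtain f where f: "f \<in> hom D (F0 J X) (TOb T Y)" "isomorphic D u (Star T X Y f)"
    using u X Y self_extending_iff_isomorphic_Star by blast
  have "D.self_extending (TI T X') (id1 D (TOb T X'))"
    using closed X by (simp add: closed_under_extension_def)
  \<comment> \<open>The identity is read as a morphism from the object presented by
    \<open>X'\<close> to the same object presented by \<open>X\<close>. It is isomorphic to an
    extension of some \<open>h\<close>, so \<open>u\<close>, being isomorphic to \<open>u\<close>
    composed with the identity, becomes a composite of two extensions whose source is presented by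
    \<open>X'\<close>.\<close>
  then obtain h where h: "h \<in> hom D (F0 J X') (TOb T X)"
      "isomorphic D (id1 D (TOb T X')) (Star T X' X h)"
    using X self_extending_iff_isomorphic_Star[of X' X "id1 D (TOb T X')"] by (auto simp: hom_def)
  have "isomorphic D (u \<odot>\<^bsub>D\<^esub> id1 D (TOb T X')) (Star T X Y f \<odot>\<^bsub>D\<^esub> Star T X' X h)"
    using f h u X by (intro D.isomorphic_comp1) (auto simp: hom_def)
  then have "isomorphic D (Star T X Y f \<odot>\<^bsub>D\<^esub> Star T X' X h) u"
    using u X D.isomorphic_runit D.isomorphic_trans D.isomorphic_sym by metis
  moreover have "D.self_extending (TI T X') (Star T X Y f \<odot>\<^bsub>D\<^esub> Star T X' X h)"
    using closed X Y f h by (simp add: closed_under_extension_def)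
  ultimately show ?thesis
    using D.self_extending_isomorphic by blast
qed

end

section \<open>The pseudomonad structure induced by left extensions\<close>

context relative_left_Kan_pseudomonad
begin

text \<open>The only choice that makes the unit natural: its defining equation is
  \<open>Eta_natural\<close>.\<close>

definition star2 :: "'p \<Rightarrow> 'p \<Rightarrow> 'c \<Rightarrow> 'c"
  where "star2 X Y \<alpha> = D.factor (TI T X) (Star T X Y (Dom D \<alpha>)) (Eta T X Y (Dom D \<alpha>))
    (Star T X Y (Cod D \<alpha>)) (Eta T X Y (Cod D \<alpha>) \<cdot> \<alpha>)"

text \<open>The equation \<open>Mu_Eta\<close> of lax idempotence, with the associator moved to the
  other side, leaves no other choice. In the same way \<open>theta\<close> below is forced by
  \<open>Theta_Eta\<close>.\<close>

definition mu :: "'p \<Rightarrow> 'p \<Rightarrow> 'p \<Rightarrow> 'a \<Rightarrow> 'a \<Rightarrow> 'c"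
  where "mu X Y Z g f = D.factor (TI T X) (Star T X Z (Star T Y Z g \<odot> f)) (Eta T X Z (Star T Y Z g \<odot> f))
    (Star T Y Z g \<odot> Star T X Y f)
    (inv2 D (assoc D (Star T Y Z g) (Star T X Y f) (TI T X)) \<cdot> (Star T Y Z g \<lhd> Eta T X Y f))"

definition theta :: "'p \<Rightarrow> 'c"
  where "theta X = D.factor (TI T X) (Star T X X (TI T X)) (Eta T X X (TI T X))
    (id1 D (TOb T X)) (inv2 D (lunit D (TI T X)))"

lemma Star_eqI:
  assumes "X \<in> Obj C" "Y \<in> Obj C" "f \<in> Arr D" "Src D f = F0 J X" "Trg D f = TOb T Y"
    "\<phi> \<in> Cell D" "\<psi> \<in> Cell D" "Dom D \<phi> = Star T X Y f" "Dom D \<psi> = Star T X Y f" "Cod D \<phi> = Cod D \<psi>"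
    "(\<phi> \<rhd> TI T X) \<cdot> Eta T X Y f = (\<psi> \<rhd> TI T X) \<cdot> Eta T X Y f"
  shows "\<phi> = \<psi>"
  by (rule D.left_extension_eqI[OF Star_Eta_simps(8)[OF assms(1-5)] assms(6-11)])

text \<open>In the last clause the domain is a separate variable \<open>f\<close>, so that it can
  rewrite terms in which \<open>Dom D \<alpha>\<close> has already been evaluated.\<close>

lemma star2_simps [simp]:
  assumes "X \<in> Obj C" "Y \<in> Obj C" "\<alpha> \<in> Cell D" "Src D (Dom D \<alpha>) = F0 J X" "Trg D (Dom D \<alpha>) = TOb T Y"
  shows "star2 X Y \<alpha> \<in> Cell D" "Dom D (star2 X Y \<alpha>) = Star T X Y (Dom D \<alpha>)"
    "Cod D (star2 X Y \<alpha>) = Star T X Y (Cod D \<alpha>)"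
    "Dom D \<alpha> = f \<Longrightarrow> (star2 X Y \<alpha> \<rhd> TI T X) \<cdot> Eta T X Y f = Eta T X Y (Cod D \<alpha>) \<cdot> \<alpha>"
proof -
  have "left_extension D (TI T X) (Dom D \<alpha>) (Star T X Y (Dom D \<alpha>)) (Eta T X Y (Dom D \<alpha>))"
    using assms by simp
  note factor = D.factor[OF this, of "Star T X Y (Cod D \<alpha>)" "Eta T X Y (Cod D \<alpha>) \<cdot> \<alpha>"]
  show "star2 X Y \<alpha> \<in> Cell D" "Dom D (star2 X Y \<alpha>) = Star T X Y (Dom D \<alpha>)"
    "Cod D (star2 X Y \<alpha>) = Star T X Y (Cod D \<alpha>)"
    using assms by (simp_all add: star2_def factor)
  have "(star2 X Y \<alpha> \<rhd> TI T X) \<cdot> Eta T X Y (Dom D \<alpha>) = Eta T X Y (Cod D \<alpha>) \<cdot> \<alpha>"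
    using assms by (simp add: star2_def factor)
  then show "Dom D \<alpha> = f \<Longrightarrow> (star2 X Y \<alpha> \<rhd> TI T X) \<cdot> Eta T X Y f = Eta T X Y (Cod D \<alpha>) \<cdot> \<alpha>"
    by simp
qed

text \<open>Invertibility uses the Kan condition \<open>Star_preserves\<close>: source and target
  are both extensions of \<open>Star T Y Z g \<odot> f\<close>, and \<open>mu\<close> is the
  comparison between them. For \<open>theta\<close> the condition \<open>TI_dense\<close> plays this
  part.\<close>

lemma mu_simps [simp]:
  assumes "X \<in> Obj C" "Y \<in> Obj C" "Z \<in> Obj C"
    "f \<in> Arr D" "Src D f = F0 J X" "Trg D f = TOb T Y" "g \<in> Arr D" "Src D g = F0 J Y" "Trg D g = TOb T Z"
  shows "mu X Y Z g f \<in> Cell D" "Dom D (mu X Y Z g f) = Star T X Z (Star T Y Z g \<odot> f)"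
    "Cod D (mu X Y Z g f) = Star T Y Z g \<odot> Star T X Y f"
    "(mu X Y Z g f \<rhd> TI T X) \<cdot> Eta T X Z (Star T Y Z g \<odot> f) =
      inv2 D (assoc D (Star T Y Z g) (Star T X Y f) (TI T X)) \<cdot> (Star T Y Z g \<lhd> Eta T X Y f)"
    "invertible D (mu X Y Z g f)"
proof -
  have ext: "left_extension D (TI T X) (Star T Y Z g \<odot> f) (Star T X Z (Star T Y Z g \<odot> f))
      (Eta T X Z (Star T Y Z g \<odot> f))"
    using assms by simp
  have ext': "left_extension D (TI T X) (Star T Y Z g \<odot> f) (Star T Y Z g \<odot> Star T X Y f)
      (inv2 D (assoc D (Star T Y Z g) (Star T X Y f) (TI T X)) \<cdot> (Star T Y Z g \<lhd> Eta T X Y f))"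
    using assms by (intro Star_preserves) (auto simp: hom_def)
  note factor = D.factor[OF ext, of "Star T Y Z g \<odot> Star T X Y f"
      "inv2 D (assoc D (Star T Y Z g) (Star T X Y f) (TI T X)) \<cdot> (Star T Y Z g \<lhd> Eta T X Y f)"]
  show mu: "mu X Y Z g f \<in> Cell D" "Dom D (mu X Y Z g f) = Star T X Z (Star T Y Z g \<odot> f)"
    "Cod D (mu X Y Z g f) = Star T Y Z g \<odot> Star T X Y f"
    "(mu X Y Z g f \<rhd> TI T X) \<cdot> Eta T X Z (Star T Y Z g \<odot> f) =
      inv2 D (assoc D (Star T Y Z g) (Star T X Y f) (TI T X)) \<cdot> (Star T Y Z g \<lhd> Eta T X Y f)"
    using assms by (simp_all add: mu_def factor)
  show "invertible D (mu X Y Z g f)"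
    by (rule D.left_extension_comparison_invertible[OF ext ext' mu])
qed

lemma theta_simps [simp]:
  assumes "X \<in> Obj C"
  shows "theta X \<in> Cell D" "Dom D (theta X) = Star T X X (TI T X)" "Cod D (theta X) = id1 D (TOb T X)"
    "(theta X \<rhd> TI T X) \<cdot> Eta T X X (TI T X) = inv2 D (lunit D (TI T X))" "invertible D (theta X)"
proof -
  have ext: "left_extension D (TI T X) (TI T X) (Star T X X (TI T X)) (Eta T X X (TI T X))"
    using assms by simp
  note factor = D.factor[OF ext, of "id1 D (TOb T X)" "inv2 D (lunit D (TI T X))"]
  show theta: "theta X \<in> Cell D" "Dom D (theta X) = Star T X X (TI T X)" "Cod D (theta X) = id1 D (TOb T X)"
    "(theta X \<rhd> TI T X) \<cdot> Eta T X X (TI T X) = inv2 D (lunit D (TI T X))"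
    using assms by (simp_all add: theta_def factor)
  show "invertible D (theta X)"
    by (rule D.left_extension_comparison_invertible[OF ext TI_dense[OF assms] theta])
qed

lemmas star2_Eta = D.vcomp_rewrite[OF star2_simps(4)]
lemmas mu_Eta = D.vcomp_rewrite[OF mu_simps(4)]

lemma star2_id2:
  assumes "X \<in> Obj C" "Y \<in> Obj C" "f \<in> Arr D" "Src D f = F0 J X" "Trg D f = TOb T Y"
  shows "star2 X Y (id2 D f) = id2 D (Star T X Y f)"
  by (rule Star_eqI[OF assms]) (use assms in simp_all)

lemma star2_vcomp:
  assumes "X \<in> Obj C" "Y \<in> Obj C" "\<alpha> \<in> Cell D" "\<beta> \<in> Cell D" "Dom D \<beta> = Cod D \<alpha>"
    "Src D (Dom D \<alpha>) = F0 J X" "Trg D (Dom D \<alpha>) = TOb T Y"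
  shows "star2 X Y (\<beta> \<cdot> \<alpha>) = star2 X Y \<beta> \<cdot> star2 X Y \<alpha>"
  by (rule Star_eqI[of X Y "Dom D \<alpha>"]) (use assms in \<open>simp_all add: star2_Eta\<close>)

lemma mu_natural:
  assumes [simp]: "X \<in> Obj C" "Y \<in> Obj C" "Z \<in> Obj C" "\<alpha> \<in> Cell D" "\<beta> \<in> Cell D"
    and [simp]: "Src D (Dom D \<alpha>) = F0 J X" "Trg D (Dom D \<alpha>) = TOb T Y"
      "Src D (Dom D \<beta>) = F0 J Y" "Trg D (Dom D \<beta>) = TOb T Z"
  shows "mu X Y Z (Cod D \<beta>) (Cod D \<alpha>) \<cdot> star2 X Z (star2 Y Z \<beta> \<star> \<alpha>) =
    (star2 Y Z \<beta> \<star> star2 X Y \<alpha>) \<cdot> mu X Y Z (Dom D \<beta>) (Dom D \<alpha>)"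
proof (rule Star_eqI[of X Z "Star T Y Z (Dom D \<beta>) \<odot> Dom D \<alpha>"])
  let ?i = "TI T X" and ?f = "Dom D \<alpha>" and ?f' = "Cod D \<alpha>" and ?g = "Dom D \<beta>" and ?g' = "Cod D \<beta>"
  let ?gs = "Star T Y Z ?g" and ?gs' = "Star T Y Z ?g'" and ?fs = "Star T X Y ?f" and ?fs' = "Star T X Y ?f'"
  let ?\<alpha>s = "star2 X Y \<alpha>" and ?\<beta>s = "star2 Y Z \<beta>"
  have "((mu X Y Z ?g' ?f' \<cdot> star2 X Z (?\<beta>s \<star> \<alpha>)) \<rhd> ?i) \<cdot> Eta T X Z (?gs \<odot> ?f) =
      inv2 D (assoc D ?gs' ?fs' ?i) \<cdot> (?gs' \<lhd> Eta T X Y ?f') \<cdot> (?\<beta>s \<star> \<alpha>)"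
    by (simp add: mu_Eta)
  \<comment> \<open>Interchange collects everything acting on the inner factor, where naturality of
    the unit can be used, and then splits the result the other way.\<close>
  also have "(?gs' \<lhd> Eta T X Y ?f') \<cdot> (?\<beta>s \<star> \<alpha>) = ?\<beta>s \<star> (Eta T X Y ?f' \<cdot> \<alpha>)"
    unfolding whisker_left_def by (subst D.interchange'[symmetric]) simp_all
  also have "Eta T X Y ?f' \<cdot> \<alpha> = (?\<alpha>s \<rhd> ?i) \<cdot> Eta T X Y ?f"
    by simp
  also have "?\<beta>s \<star> ((?\<alpha>s \<rhd> ?i) \<cdot> Eta T X Y ?f) = (?\<beta>s \<star> (?\<alpha>s \<star> id2 D ?i)) \<cdot> (?gs \<lhd> Eta T X Y ?f)"
    unfolding whisker_left_def whisker_right_def by (subst D.interchange'[symmetric]) simp_all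
  \<comment> \<open>A cancelling pair is inserted so that naturality of the associator applies to
    the threefold horizontal composite.\<close>
  also have "\<dots> = (?\<beta>s \<star> (?\<alpha>s \<star> id2 D ?i)) \<cdot> assoc D ?gs ?fs ?i \<cdot> inv2 D (assoc D ?gs ?fs ?i) \<cdot>
      (?gs \<lhd> Eta T X Y ?f)"
    by simp
  also have "\<dots> = assoc D ?gs' ?fs' ?i \<cdot> ((?\<beta>s \<star> ?\<alpha>s) \<rhd> ?i) \<cdot> inv2 D (assoc D ?gs ?fs ?i) \<cdot>
      (?gs \<lhd> Eta T X Y ?f)"
    using D.assoc_natural'[of "id2 D ?i" ?\<alpha>s ?\<beta>s]
    by (subst D.vcomp_rewrite[where \<delta> = "assoc D ?gs' ?fs' ?i \<cdot> ((?\<beta>s \<star> ?\<alpha>s) \<rhd> ?i)"])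
      (simp_all add: whisker_right_def)
  also have "inv2 D (assoc D ?gs' ?fs' ?i) \<cdot> \<dots> =
      (((?\<beta>s \<star> ?\<alpha>s) \<cdot> mu X Y Z ?g ?f) \<rhd> ?i) \<cdot> Eta T X Z (?gs \<odot> ?f)"
    by simp
  finally show "((mu X Y Z ?g' ?f' \<cdot> star2 X Z (?\<beta>s \<star> \<alpha>)) \<rhd> ?i) \<cdot> Eta T X Z (?gs \<odot> ?f) =
      (((?\<beta>s \<star> ?\<alpha>s) \<cdot> mu X Y Z ?g ?f) \<rhd> ?i) \<cdot> Eta T X Z (?gs \<odot> ?f)" .
qed simp_all

lemma mu_unit:
  assumes [simp]: "X \<in> Obj C" "Y \<in> Obj C" "f \<in> Arr D" "Src D f = F0 J X" "Trg D f = TOb T Y"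
  shows "runit D (Star T X Y f) \<cdot> (Star T X Y f \<lhd> theta X) \<cdot> mu X X Y f (TI T X) \<cdot>
    star2 X Y (Eta T X Y f) = id2 D (Star T X Y f)"
proof (rule Star_eqI[of X Y f])
  let ?i = "TI T X" and ?fs = "Star T X Y f"
  \<comment> \<open>The triangle identity trades the right unitor at \<open>f*\<close> for the left
    unitor at \<open>i\<close>, which is the one occurring in the defining equation of
    \<open>theta\<close>.\<close>
  have triangle: "runit D ?fs \<rhd> ?i = (?fs \<lhd> lunit D ?i) \<cdot> assoc D ?fs (id1 D (TOb T X)) ?i"
    by (rule D.triangle[symmetric, of _ "F0 J X" _ _ "TOb T Y"]) (simp_all add: hom_def)
  have "((runit D ?fs \<cdot> (?fs \<lhd> theta X) \<cdot> mu X X Y f ?i \<cdot> star2 X Y (Eta T X Y f)) \<rhd> ?i) \<cdot> Eta T X Y f =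
      (?fs \<lhd> lunit D ?i) \<cdot> (assoc D ?fs (id1 D (TOb T X)) ?i \<cdot> ((?fs \<lhd> theta X) \<rhd> ?i)) \<cdot>
      inv2 D (assoc D ?fs (Star T X X ?i) ?i) \<cdot> (?fs \<lhd> Eta T X X ?i) \<cdot> Eta T X Y f"
    by (simp add: mu_Eta triangle)
  also have "assoc D ?fs (id1 D (TOb T X)) ?i \<cdot> ((?fs \<lhd> theta X) \<rhd> ?i) =
      (?fs \<lhd> (theta X \<rhd> ?i)) \<cdot> assoc D ?fs (Star T X X ?i) ?i"
    by (rule D.assoc_whisker_middle) simp_all
  \<comment> \<open>The defining equation of \<open>theta\<close> is withheld for the moment: used
    now, it would collapse the right-hand side, while on the left its factors are still whiskered
    separately.\<close>
  also have "(?fs \<lhd> lunit D ?i) \<cdot> (\<dots>) \<cdot>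
      inv2 D (assoc D ?fs (Star T X X ?i) ?i) \<cdot> (?fs \<lhd> Eta T X X ?i) \<cdot> Eta T X Y f =
      (?fs \<lhd> (lunit D ?i \<cdot> (theta X \<rhd> ?i) \<cdot> Eta T X X ?i)) \<cdot> Eta T X Y f"
    by (simp del: theta_simps(4))
  also have "\<dots> = Eta T X Y f"
    by simp
  finally show "((runit D ?fs \<cdot> (?fs \<lhd> theta X) \<cdot> mu X X Y f ?i \<cdot> star2 X Y (Eta T X Y f)) \<rhd> ?i) \<cdot>
      Eta T X Y f = (id2 D ?fs \<rhd> ?i) \<cdot> Eta T X Y f"
    by simp
qed simp_all

text \<open>Restricted along the unit, both sides reduce, up to the common invertible factor, to the
  unit at \<open>f\<close> whiskered by two extensions after \<open>mu Y Z V h g \<rhd> f\<close>.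
  On the left this is two uses of the defining equation of \<open>mu\<close>; on the right it is the
  pentagon followed by an exchange of whiskerings.\<close>

lemma mu_assoc:
  assumes [simp]: "X \<in> Obj C" "Y \<in> Obj C" "Z \<in> Obj C" "V \<in> Obj C"
    and [simp]: "f \<in> Arr D" "Src D f = F0 J X" "Trg D f = TOb T Y"
      "g \<in> Arr D" "Src D g = F0 J Y" "Trg D g = TOb T Z" "h \<in> Arr D" "Src D h = F0 J Z" "Trg D h = TOb T V"
  shows "(Star T Z V h \<lhd> mu X Y Z g f) \<cdot> mu X Z V h (Star T Y Z g \<odot> f) \<cdot>
      star2 X V (assoc D (Star T Z V h) (Star T Y Z g) f \<cdot> (mu Y Z V h g \<rhd> f)) =
    assoc D (Star T Z V h) (Star T Y Z g) (Star T X Y f) \<cdot>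
      (mu Y Z V h g \<rhd> Star T X Y f) \<cdot> mu X Y V (Star T Z V h \<odot> g) f"
proof (rule Star_eqI[of X V "Star T Y V (Star T Z V h \<odot> g) \<odot> f"])
  let ?i = "TI T X" and ?fs = "Star T X Y f" and ?gs = "Star T Y Z g" and ?hs = "Star T Z V h"
  let ?hgs = "Star T Y V (?hs \<odot> g)" and ?gfs = "Star T X Z (?gs \<odot> f)"
  let ?\<mu> = "mu Y Z V h g" and ?\<eta> = "Eta T X Y f" and ?\<eta>' = "Eta T X V (?hgs \<odot> f)"
  let ?a = "assoc D"
  let ?l = "(?hs \<lhd> mu X Y Z g f) \<cdot> mu X Z V h (?gs \<odot> f) \<cdot> star2 X V (?a ?hs ?gs f \<cdot> (?\<mu> \<rhd> f))"
  let ?r = "?a ?hs ?gs ?fs \<cdot> (?\<mu> \<rhd> ?fs) \<cdot> mu X Y V (?hs \<odot> g) f"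
  let ?c = "?hs \<lhd> ?a ?gs ?fs ?i" and ?d = "?a ?hs (?gs \<odot> ?fs) ?i"
  text \<open>Composing with the invertible \<open>?c \<cdot> ?d\<close> makes the pentagon applicable to the right-hand side.\<close>
  have "?c \<cdot> ?d \<cdot> (?l \<rhd> ?i) \<cdot> ?\<eta>' = ?c \<cdot> (?d \<cdot> ((?hs \<lhd> mu X Y Z g f) \<rhd> ?i)) \<cdot>
      inv2 D (?a ?hs ?gfs ?i) \<cdot> (?hs \<lhd> Eta T X Z (?gs \<odot> f)) \<cdot> ?a ?hs ?gs f \<cdot> (?\<mu> \<rhd> f)"
    by (simp add: mu_Eta)
  also have "?d \<cdot> ((?hs \<lhd> mu X Y Z g f) \<rhd> ?i) = (?hs \<lhd> (mu X Y Z g f \<rhd> ?i)) \<cdot> ?a ?hs ?gfs ?i"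
    by (rule D.assoc_whisker_middle) simp_all
  also have "?c \<cdot> (\<dots>) \<cdot> inv2 D (?a ?hs ?gfs ?i) \<cdot> (?hs \<lhd> Eta T X Z (?gs \<odot> f)) \<cdot> ?a ?hs ?gs f \<cdot> (?\<mu> \<rhd> f) =
      ?c \<cdot> ((?hs \<lhd> (mu X Y Z g f \<rhd> ?i)) \<cdot> (?hs \<lhd> Eta T X Z (?gs \<odot> f))) \<cdot> ?a ?hs ?gs f \<cdot> (?\<mu> \<rhd> f)"
    by simp
  also have "(?hs \<lhd> (mu X Y Z g f \<rhd> ?i)) \<cdot> (?hs \<lhd> Eta T X Z (?gs \<odot> f)) =
      ?hs \<lhd> (inv2 D (?a ?gs ?fs ?i) \<cdot> (?gs \<lhd> ?\<eta>))"
    by (subst D.whisker_left_vcomp[symmetric]) simp_all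
  \<comment> \<open>Cancellation is switched off until the associator and its inverse stand under
    one common whiskering by \<open>?hs\<close>.\<close>
  also have "?c \<cdot> (\<dots>) \<cdot> ?a ?hs ?gs f \<cdot> (?\<mu> \<rhd> f) =
      (?hs \<lhd> (?a ?gs ?fs ?i \<cdot> inv2 D (?a ?gs ?fs ?i) \<cdot> (?gs \<lhd> ?\<eta>))) \<cdot> ?a ?hs ?gs f \<cdot> (?\<mu> \<rhd> f)"
    by (simp del: D.inv2_cancel D.inv2_simps(4,5))
  also have "\<dots> = ((?hs \<lhd> ?gs \<lhd> ?\<eta>) \<cdot> ?a ?hs ?gs f) \<cdot> (?\<mu> \<rhd> f)"
    by simp
  also have "(?hs \<lhd> ?gs \<lhd> ?\<eta>) \<cdot> ?a ?hs ?gs f = ?a ?hs ?gs (?fs \<odot> ?i) \<cdot> ((?hs \<odot> ?gs) \<lhd> ?\<eta>)"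
    by (rule D.assoc_whisker_left[symmetric]) simp_all
  finally have l: "?c \<cdot> ?d \<cdot> (?l \<rhd> ?i) \<cdot> ?\<eta>' = (?a ?hs ?gs (?fs \<odot> ?i) \<cdot> ((?hs \<odot> ?gs) \<lhd> ?\<eta>)) \<cdot> (?\<mu> \<rhd> f)" .
  have "?c \<cdot> ?d \<cdot> (?r \<rhd> ?i) \<cdot> ?\<eta>' = (?c \<cdot> ?d \<cdot> (?a ?hs ?gs ?fs \<rhd> ?i)) \<cdot> ((?\<mu> \<rhd> ?fs) \<rhd> ?i) \<cdot>
      inv2 D (?a ?hgs ?fs ?i) \<cdot> (?hgs \<lhd> ?\<eta>)"
    by simp
  also have "?c \<cdot> ?d \<cdot> (?a ?hs ?gs ?fs \<rhd> ?i) = ?a ?hs ?gs (?fs \<odot> ?i) \<cdot> ?a (?hs \<odot> ?gs) ?fs ?i"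
    by (rule D.pentagon') simp_all
  also have "(\<dots>) \<cdot> ((?\<mu> \<rhd> ?fs) \<rhd> ?i) \<cdot> inv2 D (?a ?hgs ?fs ?i) \<cdot> (?hgs \<lhd> ?\<eta>) =
      ?a ?hs ?gs (?fs \<odot> ?i) \<cdot> (?a (?hs \<odot> ?gs) ?fs ?i \<cdot> ((?\<mu> \<rhd> ?fs) \<rhd> ?i)) \<cdot> inv2 D (?a ?hgs ?fs ?i) \<cdot> (?hgs \<lhd> ?\<eta>)"
    by simp
  also have "?a (?hs \<odot> ?gs) ?fs ?i \<cdot> ((?\<mu> \<rhd> ?fs) \<rhd> ?i) = (?\<mu> \<rhd> (?fs \<odot> ?i)) \<cdot> ?a ?hgs ?fs ?i"
    by (rule D.assoc_whisker_right) simp_all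
  also have "?a ?hs ?gs (?fs \<odot> ?i) \<cdot> (\<dots>) \<cdot> inv2 D (?a ?hgs ?fs ?i) \<cdot> (?hgs \<lhd> ?\<eta>) =
      ?a ?hs ?gs (?fs \<odot> ?i) \<cdot> (?\<mu> \<rhd> (?fs \<odot> ?i)) \<cdot> (?hgs \<lhd> ?\<eta>)"
    by simp
  also have "(?\<mu> \<rhd> (?fs \<odot> ?i)) \<cdot> (?hgs \<lhd> ?\<eta>) = ((?hs \<odot> ?gs) \<lhd> ?\<eta>) \<cdot> (?\<mu> \<rhd> f)"
    by (rule D.whisker_exchange) simp_all
  also have "?a ?hs ?gs (?fs \<odot> ?i) \<cdot> \<dots> = ?c \<cdot> ?d \<cdot> (?l \<rhd> ?i) \<cdot> ?\<eta>'"
    unfolding l by simp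
  finally have eq: "?c \<cdot> ?d \<cdot> (?l \<rhd> ?i) \<cdot> ?\<eta>' = ?c \<cdot> ?d \<cdot> (?r \<rhd> ?i) \<cdot> ?\<eta>'"
    by (rule sym)
  \<comment> \<open>The two sides are made opaque, so that simplification does not expand them while
    \<open>?c\<close> and then \<open>?d\<close> are cancelled.\<close>
  define L R where "L = (?l \<rhd> ?i) \<cdot> ?\<eta>'" and "R = (?r \<rhd> ?i) \<cdot> ?\<eta>'"
  have LR: "L \<in> Cell D" "R \<in> Cell D"
    "Cod D L = (?hs \<odot> ?gs \<odot> ?fs) \<odot> ?i" "Cod D R = (?hs \<odot> ?gs \<odot> ?fs) \<odot> ?i"
    by (simp_all add: L_def R_def)
  have "?d \<cdot> L = ?d \<cdot> R"
    by (rule D.invertible_cancel_left[OF _ eq[folded L_def R_def]]) (simp_all add: LR)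
  then have "L = R"
    by (rule D.invertible_cancel_left[rotated]) (simp_all add: LR)
  then show "(?l \<rhd> ?i) \<cdot> ?\<eta>' = (?r \<rhd> ?i) \<cdot> ?\<eta>'"
    by (simp only: L_def R_def)
qed simp_all

lemma lax_idempotent_structure:
  "lax_idempotent_relative_pseudomonad C D J
    \<lparr>TOb = TOb T, TI = TI T, Star = Star T, Eta = Eta T, Star2 = star2, Mu = mu, Theta = theta\<rparr>"
    (is "lax_idempotent_relative_pseudomonad C D J ?P")
proof -
  have "relative_pseudomonad_axioms C D J ?P"
  proof (rule relative_pseudomonad_axioms.intro, goal_cases)
    case 1 then show ?case by simp
  next
    case 2 then show ?case using Star_hom by simp
  next
    case (3 X Y f \<alpha> f')
    \<comment> \<open>Boundaries are eliminated in favour of \<open>Dom\<close> and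
      \<open>Cod\<close>, through which \<open>star2\<close> is defined.\<close>
    then have f: "f = Dom D \<alpha>" "f' = Cod D \<alpha>" by (auto simp: cells_def)
    show ?case using 3 unfolding f by (auto simp: hom_def cells_def)
  next
    case 4 then show ?case using star2_id2 by (simp add: hom_def)
  next
    case (5 X Y f \<alpha> f' \<beta> f'')
    then have f: "f = Dom D \<alpha>" by (auto simp: cells_def)
    show ?case using 5 star2_vcomp[of X Y \<alpha> \<beta>] unfolding f by (auto simp: hom_def cells_def)
  next
    case 6 then show ?case using TI_hom by simp
  next
    case 7 then show ?case by (intro D.isosI) (simp_all add: hom_def)
  next
    case (8 X Y Z f g \<alpha> f' \<beta> g')
    then have f: "f = Dom D \<alpha>" "f' = Cod D \<alpha>" "g = Dom D \<beta>" "g' = Cod D \<beta>"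
      by (auto simp: cells_def)
    show ?case using 8 mu_natural[of X Y Z \<alpha> \<beta>] unfolding f by (auto simp: hom_def cells_def)
  next
    case 9 then show ?case using Eta_isos by simp
  next
    case (10 X Y f \<alpha> f')
    then have f: "f = Dom D \<alpha>" "f' = Cod D \<alpha>" by (auto simp: cells_def)
    show ?case using 10 star2_simps(4)[of X Y \<alpha> "Dom D \<alpha>"] unfolding f by (auto simp: hom_def cells_def)
  next
    case 11 then show ?case by (intro D.isosI) simp_all
  next
    case (12 X Y Z V f g h)
    then show ?case using mu_assoc[of X Y Z V f g h] by (simp add: hom_def)
  next
    case (13 X Y f)
    then show ?case using mu_unit[of X Y f] by (simp add: hom_def)
  qed
  then have "relative_pseudomonad C D J ?P"
    using pseudofunctor_axioms by (simp add: relative_pseudomonad_def)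
  \<comment> \<open>The last two axioms are the defining equations of \<open>mu\<close> and
    \<open>theta\<close>, with the inverse associator or unitor cancelled.\<close>
  moreover have "lax_idempotent_relative_pseudomonad_axioms C D J ?P"
  proof (rule lax_idempotent_relative_pseudomonad_axioms.intro, goal_cases)
    case 1 then show ?case using Eta_left_extension by simp
  next
    case 2 then show ?case by (simp add: hom_def)
  next
    case 3 then show ?case by simp
  qed
  ultimately show ?thesis
    by (simp add: lax_idempotent_relative_pseudomonad_def)
qed

end

section \<open>The equivalence\<close>

context relative_extension
begin

text \<open>Forward, the components \<open>Mu\<close> and \<open>Theta\<close> supply the
  isomorphisms of \<open>closed_under_extension_iff_isomorphic\<close>. Backward, the closure
  condition makes \<open>T\<close> a left Kan pseudomonad, whose induced structure extends the given
  record.\<close>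

lemma lax_idempotent_iff:
  "(\<exists>P :: ('p, 'o, 'a, 'c) relpsmonad.
      ext_data.truncate P = T \<and> lax_idempotent_relative_pseudomonad C D J P) \<longleftrightarrow>
    closed_under_extension"
proof
  assume "\<exists>P :: ('p, 'o, 'a, 'c) relpsmonad.
      ext_data.truncate P = T \<and> lax_idempotent_relative_pseudomonad C D J P"
  then obtain P :: "('p, 'o, 'a, 'c) relpsmonad"
    where P: "ext_data.truncate P = T" "lax_idempotent_relative_pseudomonad C D J P"
    by blast
  from P(1) have T: "TOb P = TOb T" "TI P = TI T" "Star P = Star T"
    by (auto simp: ext_data.truncate_def)
  interpret P: lax_idempotent_relative_pseudomonad C D J P
    by (rule P(2))
  show closed_under_extension
    using P.Mu_isos P.Theta_isos
    unfolding closed_under_extension_iff_isomorphic isomorphic_def T by blast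
next
  assume closed_under_extension
  then interpret K: relative_left_Kan_pseudomonad C D J T
    by (simp add: relative_left_Kan_pseudomonad_iff)
  show "\<exists>P :: ('p, 'o, 'a, 'c) relpsmonad.
      ext_data.truncate P = T \<and> lax_idempotent_relative_pseudomonad C D J P"
    using K.lax_idempotent_structure by (intro exI conjI) (auto simp: ext_data.truncate_def)
qed

lemma invertible_counit_Star:
  assumes "X \<in> Obj C" "Y \<in> Obj C" "f \<in> hom D (F0 J X) (TOb T Y)"
  shows "invertible D (counit D T X Y (Star T X Y f))"
  using assms self_extending_Star[OF assms] invertible_counit_iff Star_hom by blast

text \<open>Invertible counits make every morphism of \<open>E\<close> between the objects in
  question self-extending, and \<open>E\<close> contains the required identities and composites.
  Identities and composition in \<open>E\<close> are those of \<open>D\<close>.\<close>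

lemma reflecting_sub_bicategory_closed:
  assumes E: "sub_bicategory E D"
    and Star: "\<And>X Y f. \<lbrakk>X \<in> Obj C; Y \<in> Obj C; f \<in> hom D (F0 J X) (TOb T Y)\<rbrakk> \<Longrightarrow>
      Star T X Y f \<in> hom E (TOb T X) (TOb T Y)"
    and counit: "\<And>X Y u. \<lbrakk>X \<in> Obj C; Y \<in> Obj C; u \<in> hom E (TOb T X) (TOb T Y)\<rbrakk> \<Longrightarrow>
      invertible D (counit D T X Y u)"
  shows closed_under_extension
proof -
  have "\<exists>O' A' C'. E = D\<lparr>Obj := O', Arr := A', Cell := C'\<rparr>"
    using E unfolding sub_bicategory_def by blast
  then have [simp]: "id1 E = id1 D" "comp1 E = comp1 D"
    by auto
  have hom: "hom E X Y \<subseteq> hom D X Y" for X Y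
  proof -
    have "Src E = Src D" "Trg E = Trg D"
      using \<open>\<exists>O' A' C'. E = D\<lparr>Obj := O', Arr := A', Cell := C'\<rparr>\<close> by auto
    then show ?thesis
      using E by (auto simp: sub_bicategory_def hom_def)
  qed
  interpret E: bicategory E
    using E by (simp add: sub_bicategory_def)
  have self: "D.self_extending (TI T X) u"
    if "X \<in> Obj C" "Y \<in> Obj C" "u \<in> hom E (TOb T X) (TOb T Y)" for X Y u
    using that counit hom invertible_counit_iff by blast
  have "D.self_extending (TI T X) (id1 D (TOb T X))" if X: "X \<in> Obj C" for X
  proof -
    \<comment> \<open>The object lies in \<open>E\<close> because it is the source of the extension
      of \<open>TI T X\<close>, which is a morphism of \<open>E\<close>.\<close>
    have "TOb T X \<in> Obj E"
      using Star[OF X X TI_hom[OF X]] E.src_trg[of "Star T X X (TI T X)"] by (auto simp: hom_def)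
    then show ?thesis
      using self[OF X X] E.id1_hom by simp
  qed
  moreover have "D.self_extending (TI T X) (Star T Y Z g \<odot>\<^bsub>D\<^esub> Star T X Y f)"
    if "X \<in> Obj C" "Y \<in> Obj C" "Z \<in> Obj C"
      "f \<in> hom D (F0 J X) (TOb T Y)" "g \<in> hom D (F0 J Y) (TOb T Z)" for X Y Z f g
    using that self[of X Z] E.comp1_hom[OF Star Star] by simp
  ultimately show ?thesis
    by (simp add: closed_under_extension_def)
qed

lemma ex_full_sub_bicategory:
  assumes closed: closed_under_extension
  shows "\<exists>E. Obj E = TOb T ` Obj C \<and>
    (\<forall>X \<in> Obj C. \<forall>Y \<in> Obj C. hom E (TOb T X) (TOb T Y) =
      {u \<in> hom D (TOb T X) (TOb T Y).
        \<exists>f \<in> hom D (F0 J X) (TOb T Y). isomorphic D u (Star T X Y f)}) \<and>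
    (\<forall>u \<in> Arr E. \<forall>v \<in> Arr E. cells E u v = cells D u v) \<and>
    sub_bicategory E D"
proof -
  \<comment> \<open>Source and target may be presented by any \<open>X\<close> and \<open>Y\<close>;
    \<open>A_hom\<close> below shows that the choice is immaterial.\<close>
  define A where "A = {u. \<exists>X \<in> Obj C. \<exists>Y \<in> Obj C.
    u \<in> hom D (TOb T X) (TOb T Y) \<and> D.self_extending (TI T X) u}"
  let ?E = "D\<lparr>Obj := TOb T ` Obj C, Arr := A,
    Cell := {\<alpha> \<in> Cell D. Dom D \<alpha> \<in> A \<and> Cod D \<alpha> \<in> A}\<rparr>"
  have A_hom: "u \<in> A \<longleftrightarrow> (\<exists>f \<in> hom D (F0 J X) (TOb T Y). isomorphic D u (Star T X Y f))"
    if X: "X \<in> Obj C" "Y \<in> Obj C" and u: "u \<in> hom D (TOb T X) (TOb T Y)" for X Y u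
  proof -
    have "D.self_extending (TI T X) u" if "u \<in> A"
    proof -
      obtain X' where "X' \<in> Obj C" "TOb T X' = Src D u" "D.self_extending (TI T X') u"
        using \<open>u \<in> A\<close> by (auto simp: A_def hom_def)
      moreover have "Src D u = TOb T X"
        using u by (simp add: hom_def)
      ultimately show ?thesis
        using self_extending_along_other[OF closed, of X' X Y u] X u by simp
    qed
    moreover have "u \<in> A" if "D.self_extending (TI T X) u"
      using that X u by (auto simp: A_def)
    ultimately show ?thesis
      using self_extending_iff_isomorphic_Star[OF X u] by blast
  qed
  have "sub_bicategory ?E D"
  proof (rule D.full_sub_bicategory)
    show "A \<subseteq> Arr D" "TOb T ` Obj C \<subseteq> Obj D"
      by (auto simp: A_def hom_def)
    show "Src D u \<in> TOb T ` Obj C \<and> Trg D u \<in> TOb T ` Obj C" if "u \<in> A" for u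
      using that by (auto simp: A_def hom_def)
    show "id1 D O' \<in> A" if O': "O' \<in> TOb T ` Obj C" for O'
    proof -
      obtain X where X: "X \<in> Obj C" "O' = TOb T X"
        using O' by auto
      then have "id1 D O' \<in> hom D (TOb T X) (TOb T X)" "D.self_extending (TI T X) (id1 D O')"
        using closed D.id1_hom TOb_Obj by (auto simp: closed_under_extension_def)
      with X(1) show ?thesis
        by (auto simp: A_def)
    qed
    show "v \<odot>\<^bsub>D\<^esub> u \<in> A" if uv: "u \<in> A" "v \<in> A" "Src D v = Trg D u" for u v
    proof -
      obtain Y Z where Y: "Y \<in> Obj C" "Z \<in> Obj C" "v \<in> hom D (TOb T Y) (TOb T Z)"
        using uv(2) by (auto simp: A_def)
      \<comment> \<open>The middle object is presented by the same \<open>Y\<close> for both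
        morphisms, so that the closure condition applies to the resulting \<open>f\<close> and
        \<open>g\<close>.\<close>
      obtain X where X: "X \<in> Obj C" "u \<in> hom D (TOb T X) (TOb T Y)"
        using uv Y by (auto simp: A_def hom_def)
      obtain f g where fg: "f \<in> hom D (F0 J X) (TOb T Y)" "isomorphic D u (Star T X Y f)"
        "g \<in> hom D (F0 J Y) (TOb T Z)" "isomorphic D v (Star T Y Z g)"
        using A_hom[OF X(1) Y(1) X(2)] A_hom[OF Y] uv(1,2) by blast
      then have "isomorphic D (Star T Y Z g \<odot>\<^bsub>D\<^esub> Star T X Y f) (v \<odot>\<^bsub>D\<^esub> u)"
        using D.isomorphic_sym D.isomorphic_comp1[OF _ _ X(2) Y(3)] by blast
      moreover have "D.self_extending (TI T X) (Star T Y Z g \<odot>\<^bsub>D\<^esub> Star T X Y f)"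
        using closed X Y fg by (simp add: closed_under_extension_def)
      ultimately have "D.self_extending (TI T X) (v \<odot>\<^bsub>D\<^esub> u)"
        using D.self_extending_isomorphic by blast
      then show ?thesis
        using X(1) Y(2) D.comp1_hom[OF X(2) Y(3)] unfolding A_def by blast
    qed
  qed
  moreover have "hom ?E (TOb T X) (TOb T Y) =
      {u \<in> hom D (TOb T X) (TOb T Y).
        \<exists>f \<in> hom D (F0 J X) (TOb T Y). isomorphic D u (Star T X Y f)}"
    if X: "X \<in> Obj C" "Y \<in> Obj C" for X Y
  proof -
    have "hom ?E (TOb T X) (TOb T Y) = {u \<in> hom D (TOb T X) (TOb T Y). u \<in> A}"
      by (auto simp: hom_def A_def)
    then show ?thesis
      using A_hom[OF X] by auto
  qed
  moreover have "cells ?E u v = cells D u v" if "u \<in> Arr ?E" "v \<in> Arr ?E" for u v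
    using that by (auto simp: cells_def)
  ultimately show ?thesis
    by (intro exI[of _ ?E]) simp
qed

end

theorem theorem5p3:
  fixes C :: "('p, 'b, 'e) bicat"
    and D :: "('o, 'a, 'c) bicat"
    and J :: "('p, 'b, 'e, 'o, 'a, 'c) psfunctor"
    and T :: "('p, 'o, 'a, 'c) ext_data"
  assumes "bicategory C"
    and "bicategory D"
    and "pseudofunctor C D J"
    and "relative_extension C D J T"
  shows "all_equivalent
    [ \<exists>P :: ('p, 'o, 'a, 'c) relpsmonad.
        ext_data.truncate P = T \<and> lax_idempotent_relative_pseudomonad C D J P,

      (\<forall>X \<in> Obj C. \<forall>Y \<in> Obj C. \<forall>f \<in> hom D (F0 J X) (TOb T Y).
        invertible D (counit D T X Y (Star T X Y f))) \<and>
      (\<forall>X \<in> Obj C. \<forall>Y \<in> Obj C. \<forall>Z \<in> Obj C.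
        \<forall>f \<in> hom D (F0 J X) (TOb T Y). \<forall>g \<in> hom D (F0 J Y) (TOb T Z).
        \<exists>\<mu>. \<mu> \<in> isos D (Star T X Z (Star T Y Z g \<odot>\<^bsub>D\<^esub> f)) (Star T Y Z g \<odot>\<^bsub>D\<^esub> Star T X Y f)) \<and>
      (\<forall>X \<in> Obj C. \<exists>\<theta>. \<theta> \<in> isos D (Star T X X (TI T X)) (id1 D (TOb T X))),

      \<exists>E. Obj E = TOb T ` Obj C \<and>
        (\<forall>X \<in> Obj C. \<forall>Y \<in> Obj C. hom E (TOb T X) (TOb T Y) =
          {u \<in> hom D (TOb T X) (TOb T Y).
            \<exists>f \<in> hom D (F0 J X) (TOb T Y). isomorphic D u (Star T X Y f)}) \<and>
        (\<forall>u \<in> Arr E. \<forall>v \<in> Arr E. cells E u v = cells D u v) \<and>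
        sub_bicategory E D,

      \<exists>E. sub_bicategory E D \<and>
        (\<forall>X \<in> Obj C. \<forall>Y \<in> Obj C. \<forall>f \<in> hom D (F0 J X) (TOb T Y).
          Star T X Y f \<in> hom E (TOb T X) (TOb T Y)) \<and>
        (\<forall>X \<in> Obj C. \<forall>Y \<in> Obj C. \<forall>u \<in> hom E (TOb T X) (TOb T Y).
          invertible D (counit D T X Y u)),

      relative_left_Kan_pseudomonad C D J T ]"

    (is "all_equivalent [?i, ?ii, ?iii, ?iv, ?v]")
proof -
  interpret relative_extension C D J T
    by (rule assms(4))
  have i: "?i \<longleftrightarrow> closed_under_extension"
    by (rule lax_idempotent_iff)
  have ii: "?ii \<longleftrightarrow> closed_under_extension"
    using invertible_counit_Star
    unfolding closed_under_extension_iff_isomorphic isomorphic_def by blast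
  \<comment> \<open>Conditions (iii) and (iv) are tied in by a cycle: closure yields (iii), the
    bicategory of (iii) is a witness for (iv), and (iv) gives closure back.\<close>
  have "?iii" if closed_under_extension
    by (rule ex_full_sub_bicategory[OF that])
  moreover have "?iv" if iii: "?iii"
  proof -
    obtain E where E: "sub_bicategory E D"
      and hom: "\<forall>X \<in> Obj C. \<forall>Y \<in> Obj C. hom E (TOb T X) (TOb T Y) =
          {u \<in> hom D (TOb T X) (TOb T Y).
            \<exists>f \<in> hom D (F0 J X) (TOb T Y). isomorphic D u (Star T X Y f)}"
      using iii by (elim exE conjE) (rule that; assumption)
    have "Star T X Y f \<in> hom E (TOb T X) (TOb T Y)"
      if "X \<in> Obj C" "Y \<in> Obj C" "f \<in> hom D (F0 J X) (TOb T Y)" for X Y f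
    proof -
      have "Star T X Y f \<in> hom D (TOb T X) (TOb T Y)"
        using that by (rule Star_hom)
      moreover from this have "isomorphic D (Star T X Y f) (Star T X Y f)"
        by (intro D.isomorphic_refl) (simp add: hom_def)
      ultimately show ?thesis
        using that hom by blast
    qed
    moreover have "invertible D (counit D T X Y u)"
      if "X \<in> Obj C" "Y \<in> Obj C" "u \<in> hom E (TOb T X) (TOb T Y)" for X Y u
    proof -
      have "u \<in> hom D (TOb T X) (TOb T Y)"
        "\<exists>f \<in> hom D (F0 J X) (TOb T Y). isomorphic D u (Star T X Y f)"
        using that hom by auto
      with that show ?thesis
        by (simp add: invertible_counit_iff self_extending_iff_isomorphic_Star)
    qed
    ultimately show ?thesis
      using E by blast
  qed
  moreover have closed_under_extension if "?iv"
    using that reflecting_sub_bicategory_closed by blast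
  ultimately have iii: "?iii \<longleftrightarrow> closed_under_extension" and iv: "?iv \<longleftrightarrow> closed_under_extension"
    by blast+
  show ?thesis
    unfolding i ii iii iv relative_left_Kan_pseudomonad_iff by (simp add: all_equivalent_def)
qed

end
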